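(* Let $G$ be a finite simple hypergraph. The $L_\infty$-algebra $\mathcal L(G)$ admits a symplectic form if and only if $|E(G)|+|V(G)|$ is even and $G$ has a system of distinct representatives.
   Context: A hypergraph $G$ consists of a set $V(G)$ of vertices and, for each $k>0$, a collection $E_k(G)$ of $k$-element subsets of $V(G)$ (the $k$-edges); $E(G)=\bigcup_kE_k(G)$. $G$ is finite if $V(G)$ is finite, and simple if any two distinct edges have nonempty symmetric difference. A system of distinct representatives is an injection $f:E(G)\to V(G)$ with $f(e)\in e$ for all $e\in E(G)$. $L_\infty$-algebras: for a $\mathbb Z$-graded real vector space $\mathfrak g$ (finite dimensional in each degree, bounded below), let $(\mathfrak g[1]^\vee)^i=(\mathfrak g^{1-i})^*$. Graded antisymmetric operations $l_k:\bigwedge^k\mathfrak g\to\mathfrak g$ of degree $2-k$ ($k>0$), with transposes $d_k:\mathfrak g[1]^\vee\to\mathrm{Sym}(\mathfrak g[1]^\vee)$, form an $L_\infty$-algebra if the derivation extension of $d=\sum_kd_k$ to the graded-symmetric algebra $\mathrm{Sym}(\mathfrak g[1]^\vee)$ squares to zero; $C^\bullet(\mathfrak g)=(\mathrm{Sym}(\mathfrak g[1]^\vee),d)$ is the Maurer–Cartan algebra. A symplectic form on $\mathfrak g$ is a linear map $\omega:\mathfrak g\otimes\mathfrak g\to\mathbb R$ (regarded as an element of $C^\bullet(\mathfrak g)$) that is non-degenerate and closed ($d\omega=0$). The $L_\infty$-algebra $\mathcal L(G)$: for a finite simple hypergraph $G$ with $n$ vertices, let $V$ be the real vector space with basis $\{x_i\}_{i\in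 V(G)}$, and for $k>0$ let $W_k\subseteq\bigwedge^kV$ be spanned by the $x_{i_1}\wedge\cdots\wedge x_{i_k}$ with $\{i_1,\dots,i_k\}\notin E_k(G)$. Then $\mathcal L(G)=V[0]\oplus(V/W_1)[1]\oplus(\bigwedge^2V/W_2)[0]\oplus\cdots\oplus(\bigwedge^nV/W_n)[2-n]$, where $U[m]$ denotes $U$ placed in degree $m$. The operations are $l_k(x_{i_1},\dots,x_{i_k})=x_{i_1}\wedge\cdots\wedge x_{i_k}\bmod W_k$ for $x_{i_j}\in V$, and $l_k$ vanishes whenever some argument lies in a summand $\bigwedge^pV/W_p$. Concretely, fixing an order on $V(G)$, $C^\bullet(\mathcal L(G))$ is the free graded-commutative algebra on generators $x_i^*$ ($i\in V(G)$) of degree $1$ and $x_I^*$ ($I\in E(G)$) of degree $|I|-1$, with differential the derivation determined by $dx_i^*=0$ and $dx_I^*=x_{i_1}^*\cdots x_{i_k}^*$ for $I=\{i_1<\cdots<i_k\}$. *)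

theory Defs
  imports Complex_Main
begin

text \<open>
  A hypergraph: a set of vertices and, for each \<^term>\<open>k > (0::nat)\<close>, a set of k-edges.  The
  component \<open>kedges G 0\<close> is junk and never used.
\<close>

record 'v hypergraph =
  verts :: "'v set"
  kedges :: "nat \<Rightarrow> 'v set set"

definition hypergraph :: "'v hypergraph \<Rightarrow> bool" where
  "hypergraph G \<longleftrightarrow> (\<forall>k>0. \<forall>e\<in>kedges G k. e \<subseteq> verts G \<and> card e = k)"

definition edges :: "'v hypergraph \<Rightarrow> 'v set set" where
  "edges G = (\<Union>k\<in>{0<..}. kedges G k)"

definition finite_hypergraph :: "'v hypergraph \<Rightarrow> bool" where
  "finite_hypergraph G \<longleftrightarrow> finite (verts G)"

text \<open>Edges being sets of vertices, this holds automatically.\<close>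

definition simple_hypergraph :: "'v hypergraph \<Rightarrow> bool" where
  "simple_hypergraph G \<longleftrightarrow>
     (\<forall>e\<in>edges G. \<forall>e'\<in>edges G. e \<noteq> e' \<longrightarrow> (e - e') \<union> (e' - e) \<noteq> {})"

definition distinct_representatives :: "'v hypergraph \<Rightarrow> ('v set \<Rightarrow> 'v) \<Rightarrow> bool" where
  "distinct_representatives G f \<longleftrightarrow> inj_on f (edges G) \<and> (\<forall>e\<in>edges G. f e \<in> e)"


text \<open>
  A graded real vector space with operations \<open>l\<^sub>k\<close>, presented in a homogeneous basis:
  \<open>bracket g [b\<^sub>1, \<dots>, b\<^sub>k] c\<close> is the coefficient of the basis vector \<open>c\<close>
  in \<open>l\<^sub>k(b\<^sub>1, \<dots>, b\<^sub>k)\<close>.  Values outside the basis are junk.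
\<close>

record 'b graded_ops =
  basis :: "'b set"
  deg :: "'b \<Rightarrow> int"
  bracket :: "'b list \<Rightarrow> 'b \<Rightarrow> real"

definition ksign :: "int \<Rightarrow> real" where
  "ksign n = (if even n then 1 else -1)"

text \<open>
  Graded antisymmetry of a multilinear map, given by its values on lists of basis vectors.
\<close>

definition graded_antisym :: "('b, 'm) graded_ops_scheme \<Rightarrow> ('b list \<Rightarrow> real) \<Rightarrow> bool" where
  "graded_antisym g \<phi> \<longleftrightarrow>
     (\<forall>u\<in>lists (basis g). \<forall>v\<in>lists (basis g). \<forall>a\<in>basis g. \<forall>b\<in>basis g.
        \<phi> (u @ [a, b] @ v) = - ksign (deg g a * deg g b) * \<phi> (u @ [b, a] @ v))"


text \<open>
  The dual basis vector of \<open>b\<close> is a generator of \<open>Sym(g[1]\<^sup>\<or>)\<close> of degree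
  \<open>1 - deg b\<close>.  \<open>Sym\<close> is the quotient of the tensor algebra, i.e. of the free associative
  algebra on these generators (finitely supported functions on words), by the two-sided ideal
  \<open>koszul_ideal\<close> generated by the graded commutators; an equation in \<open>Sym\<close> is
  expressed by membership of the difference in this ideal.
\<close>

definition cdeg :: "('b, 'm) graded_ops_scheme \<Rightarrow> 'b \<Rightarrow> int" where
  "cdeg g b = 1 - deg g b"

definition tensors :: "('b, 'm) graded_ops_scheme \<Rightarrow> ('b list \<Rightarrow> real) set" where
  "tensors g = {p. finite {w. p w \<noteq> 0} \<and> {w. p w \<noteq> 0} \<subseteq> lists (basis g)}"

definition word :: "'b list \<Rightarrow> 'b list \<Rightarrow> real" where
  "word u = (\<lambda>w. if w = u then 1 else 0)"

definition tmul :: "('b list \<Rightarrow> real) \<Rightarrow> ('b list \<Rightarrow> real) \<Rightarrow> 'b list \<Rightarrow> real" where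
  "tmul p q = (\<lambda>w. \<Sum>(u, v) | u @ v = w. p u * q v)"

inductive_set koszul_ideal :: "('b, 'm) graded_ops_scheme \<Rightarrow> ('b list \<Rightarrow> real) set"
  for g :: "('b, 'm) graded_ops_scheme" where
  zero: "(\<lambda>_. 0) \<in> koszul_ideal g"
| add: "p \<in> koszul_ideal g \<Longrightarrow> q \<in> koszul_ideal g \<Longrightarrow> (\<lambda>w. p w + q w) \<in> koszul_ideal g"
| scale: "p \<in> koszul_ideal g \<Longrightarrow> (\<lambda>w. r * p w) \<in> koszul_ideal g"
| comm: "\<lbrakk>u \<in> lists (basis g); v \<in> lists (basis g); a \<in> basis g; b \<in> basis g\<rbrakk> \<Longrightarrow>
    (\<lambda>w. word (u @ [a, b] @ v) w - ksign (cdeg g a * cdeg g b) * word (u @ [b, a] @ v) w)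
      \<in> koszul_ideal g"

text \<open>
  The element of \<open>Sym\<^sup>k(g[1]\<^sup>\<or>)\<close> given by a graded antisymmetric k-linear form
  \<open>\<phi>\<close> on \<open>g\<close>.  The factor \<open>1/k!\<close> identifies symmetric forms on \<open>g[1]\<close> with
  elements of \<open>Sym\<^sup>k\<close>, and the sign with exponent
  \<open>\<Sum>\<^sub>i (k - i) deg b\<^sub>i\<close> (here \<open>i\<close> counts from 0, whence the additional 1) is the
  decalage sign turning antisymmetric forms on \<open>g\<close> into symmetric forms on \<open>g[1]\<close>.
\<close>

definition form_tensor ::
    "('b, 'm) graded_ops_scheme \<Rightarrow> nat \<Rightarrow> ('b list \<Rightarrow> real) \<Rightarrow> 'b list \<Rightarrow> real" where
  "form_tensor g k \<phi> = (\<lambda>w.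
     if length w = k \<and> w \<in> lists (basis g)
     then ksign (\<Sum>i<k. (int k - 1 - int i) * deg g (w ! i)) * \<phi> w / fact k
     else 0)"

text \<open>
  \<open>d = \<Sum>\<^sub>k d\<^sub>k\<close> on the generator dual to \<open>c\<close>.  Only the summand with
  \<open>k = length w\<close> contributes to the coefficient of the word \<open>w\<close>.
\<close>

definition dgen :: "('b, 'm) graded_ops_scheme \<Rightarrow> 'b \<Rightarrow> 'b list \<Rightarrow> real" where
  "dgen g c = (\<lambda>w. if w = [] then 0 else form_tensor g (length w) (\<lambda>bs. bracket g bs c) w)"

text \<open>The extension of \<open>d\<close> to a derivation of degree 1.\<close>

primrec dword :: "('b, 'm) graded_ops_scheme \<Rightarrow> 'b list \<Rightarrow> 'b list \<Rightarrow> real" where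
  "dword g [] = (\<lambda>_. 0)"
| "dword g (c # w) = (\<lambda>u. tmul (dgen g c) (word w) u
                          + ksign (cdeg g c) * tmul (word [c]) (dword g w) u)"

definition MC_diff ::
    "('b, 'm) graded_ops_scheme \<Rightarrow> ('b list \<Rightarrow> real) \<Rightarrow> 'b list \<Rightarrow> real" where
  "MC_diff g p = (\<lambda>u. \<Sum>w | p w \<noteq> 0. p w * dword g w u)"

text \<open>
  The penultimate condition makes the sum \<open>d = \<Sum>\<^sub>k d\<^sub>k\<close> take values in
  \<open>Sym\<close> and not just in its completion.
\<close>

definition L_infinity_algebra :: "('b, 'm) graded_ops_scheme \<Rightarrow> bool" where
  "L_infinity_algebra g \<longleftrightarrow>
     (\<forall>n. finite {b \<in> basis g. deg g b = n}) \<and>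
     (\<exists>m. \<forall>b\<in>basis g. m \<le> deg g b) \<and>
     (\<forall>c\<in>basis g. graded_antisym g (\<lambda>bs. bracket g bs c)) \<and>
     (\<forall>bs\<in>lists (basis g). \<forall>c\<in>basis g. bs \<noteq> [] \<longrightarrow> bracket g bs c \<noteq> 0 \<longrightarrow>
        deg g c = sum_list (map (deg g) bs) + 2 - int (length bs)) \<and>
     (\<forall>c\<in>basis g. finite {bs \<in> lists (basis g). bs \<noteq> [] \<and> bracket g bs c \<noteq> 0}) \<and>
     (\<forall>p\<in>tensors g. MC_diff g (MC_diff g p) \<in> koszul_ideal g)"

text \<open>
  A bilinear form on \<open>g\<close>, given by its values on pairs of basis vectors.  It need not be
  homogeneous: the two arguments of a nonzero value may have arbitrary degrees.
  Finite support and graded antisymmetry say that it is an element of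
  \<open>Sym\<^sup>2(g[1]\<^sup>\<or>)\<close>; because of antisymmetry, non-degeneracy in one argument suffices.
\<close>

definition nondegenerate_form ::
    "('b, 'm) graded_ops_scheme \<Rightarrow> ('b \<Rightarrow> 'b \<Rightarrow> real) \<Rightarrow> bool" where
  "nondegenerate_form g \<omega> \<longleftrightarrow>
     (\<forall>v. finite {a. v a \<noteq> 0} \<and> {a. v a \<noteq> 0} \<subseteq> basis g \<and>
          (\<forall>b\<in>basis g. (\<Sum>a | v a \<noteq> 0. v a * \<omega> a b) = 0) \<longrightarrow> (\<forall>a. v a = 0))"

definition symplectic_form ::
    "('b, 'm) graded_ops_scheme \<Rightarrow> ('b \<Rightarrow> 'b \<Rightarrow> real) \<Rightarrow> bool" where
  "symplectic_form g \<omega> \<longleftrightarrow>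
     finite {(a, b) \<in> basis g \<times> basis g. \<omega> a b \<noteq> 0} \<and>
     (\<forall>a\<in>basis g. \<forall>b\<in>basis g. \<omega> a b = - ksign (deg g a * deg g b) * \<omega> b a) \<and>
     nondegenerate_form g \<omega> \<and>
     MC_diff g (form_tensor g 2 (\<lambda>w. \<omega> (w ! 0) (w ! 1))) \<in> koszul_ideal g"


text \<open>
  \<open>wedge_coeff r is I\<close> is the coefficient of
  \<open>x\<^sub>j\<^sub>1 \<and> \<dots> \<and> x\<^sub>j\<^sub>k\<close>, where \<open>I = {j\<^sub>1 < \<dots> < j\<^sub>k}\<close> with
  respect to the linear order \<open>r\<close>, in the wedge product of the \<open>x\<^sub>i\<close> with \<open>i\<close> running
  through the list \<open>is\<close>.
\<close>

definition wedge_coeff :: "'v rel \<Rightarrow> 'v list \<Rightarrow> 'v set \<Rightarrow> real" where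
  "wedge_coeff r is I =
     (if distinct is \<and> set is = I
      then (-1) ^ card {(i, j). i < j \<and> j < length is \<and> (is ! j, is ! i) \<in> r}
      else 0)"

text \<open>
  The algebra of a hypergraph whose vertices are ordered by \<open>r\<close>.  \<open>Inl i\<close> is the basis vector
  \<open>x\<^sub>i\<close> of \<open>V\<close>.  As \<open>W\<^sub>k\<close> is spanned by basis vectors of
  \<open>\<And>\<^sup>k V\<close>, a basis of \<open>\<And>\<^sup>k V / W\<^sub>k\<close> is given by the classes
  \<open>Inr I\<close> of the increasing wedge products over the k-edges \<open>I\<close>.
\<close>

definition hypergraph_algebra :: "'v rel \<Rightarrow> 'v hypergraph \<Rightarrow> ('v + 'v set) graded_ops" where
  "hypergraph_algebra r G = \<lparr>
     basis = Inl ` verts G \<union> Inr ` edges G,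
     deg = (\<lambda>b. case b of Inl i \<Rightarrow> 0 | Inr I \<Rightarrow> 2 - int (card I)),
     bracket = (\<lambda>bs c. case c of
        Inl i \<Rightarrow> 0
      | Inr I \<Rightarrow> if bs \<in> lists (Inl ` verts G) \<and> I \<in> kedges G (length bs)
                 then wedge_coeff r (map projl bs) I else 0) \<rparr>"


text \<open>
  The algebra of a finite hypergraph is an \<open>L\<^sub>\<infinity>\<close>-algebra.  The differential already
  squares to zero on the tensor algebra: it annihilates words in the \<open>Inl i\<close>, and maps
  every generator to a combination of such words.
\<close>

lemma finite_splits: "finite {(u, v). u @ v = (w :: 'b list)}"
proof -
  have "{(u, v). u @ v = w} \<subseteq> (\<lambda>i. (take i w, drop i w)) ` {..length w}"
  proof (clarify)
    fix u v assume "w = u @ v"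
    show "(u, v) \<in> (\<lambda>i. (take i (u @ v), drop i (u @ v))) ` {..length (u @ v)}"
      by (rule image_eqI[of _ _ "length u"]) auto
  qed
  thus ?thesis by (rule finite_subset) auto
qed

lemma tmul_assoc:
  fixes p q s :: "'b list \<Rightarrow> real"
  shows "tmul (tmul p q) s = tmul p (tmul q s)"
proof
  fix w :: "'b list"
  let ?A = "{(a, b). a @ b = w}" and ?B = "\<lambda>z. {(u, v). u @ v = z}"
  have "tmul (tmul p q) s w =
     (\<Sum>x\<in>?A. \<Sum>y\<in>?B (fst x). p (fst y) * q (snd y) * s (snd x))"
    by (simp add: tmul_def sum_distrib_right case_prod_unfold)
  also have "\<dots> = (\<Sum>(x, y)\<in>Sigma ?A (\<lambda>x. ?B (fst x)). p (fst y) * q (snd y) * s (snd x))"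
    by (rule sum.Sigma) (auto simp: finite_splits)
  also have "\<dots> = (\<Sum>(x, y)\<in>Sigma ?A (\<lambda>x. ?B (snd x)). p (fst x) * (q (fst y) * s (snd y)))"
    by (rule sum.reindex_bij_witness[of _
          "\<lambda>((a, b), (u, v)). ((a @ u, v), (a, u))" "\<lambda>((a, b), (u, v)). ((u, v @ b), (v, b))"]) auto
  also have "\<dots> = (\<Sum>x\<in>?A. \<Sum>y\<in>?B (snd x). p (fst x) * (q (fst y) * s (snd y)))"
    by (rule sum.Sigma[symmetric]) (auto simp: finite_splits)
  also have "\<dots> = tmul p (tmul q s) w"
    by (simp add: tmul_def sum_distrib_left case_prod_unfold)
  finally show "tmul (tmul p q) s w = tmul p (tmul q s) w" .
qed

lemma tmul_word: "tmul (word u) (word v) = word (u @ v)"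
proof
  fix w
  have "tmul (word u) (word v) w = (\<Sum>z\<in>{(a, b). a @ b = w}. if z = (u, v) then 1 else 0)"
    unfolding tmul_def by (rule sum.cong) (auto simp: word_def split: if_splits)
  thus "tmul (word u) (word v) w = word (u @ v) w"
    using finite_splits[of w] by (auto simp: word_def)
qed

lemma tmul_Nil [simp]: "tmul (word []) p = p" "tmul p (word []) = p"
proof -
  show "tmul (word []) p = p"
  proof
    fix w
    have "tmul (word []) p w = (\<Sum>z\<in>{(a, b). a @ b = w}. if z = ([], w) then p w else 0)"
      unfolding tmul_def by (rule sum.cong) (auto simp: word_def split: if_splits)
    thus "tmul (word []) p w = p w" using finite_splits[of w] by auto
  qed
  show "tmul p (word []) = p"
  proof
    fix w
    have "tmul p (word []) w = (\<Sum>z\<in>{(a, b). a @ b = w}. if z = (w, []) then p w else 0)"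
      unfolding tmul_def by (rule sum.cong) (auto simp: word_def split: if_splits)
    thus "tmul p (word []) w = p w" using finite_splits[of w] by auto
  qed
qed

lemma tmul_add_left: "tmul (\<lambda>w. p w + q w) s = (\<lambda>w. tmul p s w + tmul q s w)"
  by (auto simp: tmul_def case_prod_unfold distrib_right sum.distrib)

lemma tmul_add_right: "tmul s (\<lambda>w. p w + q w) = (\<lambda>w. tmul s p w + tmul s q w)"
  by (auto simp: tmul_def case_prod_unfold distrib_left sum.distrib)

lemma tmul_scale_left: "tmul (\<lambda>w. k * p w) s = (\<lambda>w. k * tmul p s w)"
  by (auto simp: tmul_def case_prod_unfold sum_distrib_left mult_ac)

lemma tmul_scale_right: "tmul s (\<lambda>w. k * p w) = (\<lambda>w. k * tmul s p w)"
  by (auto simp: tmul_def case_prod_unfold sum_distrib_left mult_ac)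

lemma tmul_zero [simp]: "tmul (\<lambda>_. 0) s = (\<lambda>_. 0)" "tmul s (\<lambda>_. 0) = (\<lambda>_. 0)"
  by (auto simp: tmul_def)

lemma tmul_sum_left:
  "tmul (\<lambda>w. \<Sum>a\<in>A. p a w) s = (\<lambda>w. \<Sum>a\<in>A. tmul (p a) s w)"
  by (induction A rule: infinite_finite_induct) (auto simp: tmul_add_left)

lemma tmul_sum_right:
  "tmul s (\<lambda>w. \<Sum>a\<in>A. p a w) = (\<lambda>w. \<Sum>a\<in>A. tmul s (p a) w)"
  by (induction A rule: infinite_finite_induct) (auto simp: tmul_add_right)

lemma finite_supp_tmul:
  assumes "finite {w. p w \<noteq> 0}" "finite {w. q w \<noteq> 0}"
  shows "finite {w. tmul p q w \<noteq> 0}"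
proof (rule finite_subset)
  show "{w. tmul p q w \<noteq> 0} \<subseteq> (\<lambda>(u, v). u @ v) ` ({w. p w \<noteq> 0} \<times> {w. q w \<noteq> 0})"
  proof
    fix w assume "w \<in> {w. tmul p q w \<noteq> 0}"
    hence "(\<Sum>(u, v) | u @ v = w. p u * q v) \<noteq> 0" by (simp add: tmul_def)
    then obtain z where "z \<in> {(u, v). u @ v = w}" "(case z of (u, v) \<Rightarrow> p u * q v) \<noteq> 0"
      by (rule sum.not_neutral_contains_not_neutral)
    thus "w \<in> (\<lambda>(u, v). u @ v) ` ({w. p w \<noteq> 0} \<times> {w. q w \<noteq> 0})" by force
  qed
qed (use assms in auto)

lemma finite_supp_word [simp]: "finite {w. word u w \<noteq> 0}"
  by (rule finite_subset[of _ "{u}"]) (auto simp: word_def)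

lemma finite_supp_add:
  "finite {w. p w \<noteq> (0::real)} \<Longrightarrow> finite {w. q w \<noteq> 0} \<Longrightarrow> finite {w. p w + q w \<noteq> 0}"
  by (rule finite_subset[of _ "{w. p w \<noteq> 0} \<union> {w. q w \<noteq> 0}"]) auto

lemma finite_supp_scale: "finite {w. p w \<noteq> (0::real)} \<Longrightarrow> finite {w. k * p w \<noteq> 0}"
  by (rule finite_subset[of _ "{w. p w \<noteq> 0}"]) auto

lemma expand_words:
  assumes "finite S" "{w. p w \<noteq> 0} \<subseteq> S"
  shows "p = (\<lambda>w. \<Sum>u\<in>S. p u * word u w)"
proof
  fix w
  have "(\<Sum>u\<in>S. p u * word u w) = (\<Sum>u\<in>S. if u = w then p w else 0)"
    by (rule sum.cong) (auto simp: word_def)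
  thus "p w = (\<Sum>u\<in>S. p u * word u w)" using assms by auto
qed

lemma finite_supp_dword:
  assumes "\<And>c. finite {w. dgen g c w \<noteq> 0}"
  shows "finite {u. dword g w u \<noteq> 0}"
  by (induction w) (auto intro!: finite_supp_add finite_supp_scale finite_supp_tmul assms)

lemma MC_diff_superset:
  assumes "finite S" "{w. p w \<noteq> 0} \<subseteq> S"
  shows "MC_diff g p = (\<lambda>u. \<Sum>w\<in>S. p w * dword g w u)"
  unfolding MC_diff_def using assms by (intro ext sum.mono_neutral_left) auto

lemma MC_diff_word [simp]: "MC_diff g (word u) = dword g u"
  by (subst MC_diff_superset[of "{u}"]) (auto simp: word_def)

lemma MC_diff_add:
  assumes "finite {w. p w \<noteq> 0}" "finite {w. q w \<noteq> 0}"
  shows "MC_diff g (\<lambda>w. p w + q w) = (\<lambda>u. MC_diff g p u + MC_diff g q u)"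
proof -
  let ?S = "{w. p w \<noteq> 0} \<union> {w. q w \<noteq> 0}"
  have "finite ?S" using assms by simp
  moreover have "{w. p w + q w \<noteq> 0} \<subseteq> ?S" by auto
  ultimately show ?thesis
    by (subst (1 2 3) MC_diff_superset[of ?S]) (auto simp: distrib_right sum.distrib)
qed

lemma MC_diff_scale:
  assumes "finite {w. p w \<noteq> 0}"
  shows "MC_diff g (\<lambda>w. k * p w) = (\<lambda>u. k * MC_diff g p u)"
  using assms
  by (subst (1 2) MC_diff_superset[of "{w. p w \<noteq> 0}"]) (auto simp: sum_distrib_left mult_ac)

lemma MC_diff_sum:
  assumes "\<And>a. a \<in> A \<Longrightarrow> finite {w. p a w \<noteq> 0}"
  shows "MC_diff g (\<lambda>w. \<Sum>a\<in>A. p a w) = (\<lambda>u. \<Sum>a\<in>A. MC_diff g (p a) u)"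
proof -
  have zero: "MC_diff g (\<lambda>_. 0) = (\<lambda>_. 0)" by (simp add: MC_diff_def)
  have fin: "finite {w. (\<Sum>a\<in>B. p a w) \<noteq> 0}" if "B \<subseteq> A" for B
  proof (cases "finite B")
    case True
    have "{w. (\<Sum>a\<in>B. p a w) \<noteq> 0} \<subseteq> (\<Union>a\<in>B. {w. p a w \<noteq> 0})"
    proof
      fix w assume "w \<in> {w. (\<Sum>a\<in>B. p a w) \<noteq> 0}"
      hence "(\<Sum>a\<in>B. p a w) \<noteq> 0" by simp
      then obtain a where "a \<in> B" "p a w \<noteq> 0" by (rule sum.not_neutral_contains_not_neutral)
      thus "w \<in> (\<Union>a\<in>B. {w. p a w \<noteq> 0})" by auto
    qed
    moreover have "finite (\<Union>a\<in>B. {w. p a w \<noteq> 0})" using True assms that by blast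
    ultimately show ?thesis by (rule finite_subset)
  qed auto
  have "MC_diff g (\<lambda>w. \<Sum>a\<in>B. p a w) = (\<lambda>u. \<Sum>a\<in>B. MC_diff g (p a) u)" if "B \<subseteq> A" for B
    using that
  proof (induction B rule: infinite_finite_induct)
    case (insert x F)
    thus ?case using assms fin[of F] by (auto simp: MC_diff_add)
  qed (auto simp: zero)
  thus ?thesis by blast
qed

lemma dword_append:
  "dword g (u @ v) = (\<lambda>x. tmul (dword g u) (word v) x
      + ksign (sum_list (map (cdeg g) u)) * tmul (word u) (dword g v) x)"
proof (induction u)
  case (Cons c u)
  have s: "ksign (a + b) = ksign a * ksign b" for a b by (auto simp: ksign_def)
  show ?case
    by (simp add: Cons.IH tmul_add_left tmul_add_right tmul_scale_left tmul_scale_right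
        tmul_assoc tmul_word s algebra_simps)
       (simp add: tmul_assoc[symmetric] tmul_word)
qed (auto simp: ksign_def)

lemma MC_diff_tmul:
  assumes fin: "\<And>c. finite {w. dgen g c w \<noteq> 0}"
    and p: "finite {w. p w \<noteq> 0}" and q: "finite {w. q w \<noteq> 0}"
  shows "MC_diff g (tmul p q) = (\<lambda>x. tmul (MC_diff g p) q x
      + tmul (\<lambda>u. ksign (sum_list (map (cdeg g) u)) * p u) (MC_diff g q) x)"
proof -
  let ?P = "{w. p w \<noteq> 0}" and ?Q = "{w. q w \<noteq> 0}"
  let ?s = "\<lambda>u. ksign (sum_list (map (cdeg g) u))"
  note pe = expand_words[OF p subset_refl] and qe = expand_words[OF q subset_refl]
  note fin_supps = finite_supp_add finite_supp_scale finite_supp_tmul finite_supp_word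
    finite_supp_dword[OF fin]
  have e: "tmul p q = (\<lambda>w. \<Sum>z\<in>?P \<times> ?Q. (p (fst z) * q (snd z)) * word (fst z @ snd z) w)"
    by (subst pe, subst qe)
       (simp add: tmul_sum_left tmul_sum_right tmul_scale_left tmul_scale_right tmul_word
          sum.cartesian_product case_prod_unfold sum_distrib_left mult.assoc)
  have "MC_diff g (tmul p q) =
      (\<lambda>x. \<Sum>z\<in>?P \<times> ?Q. (p (fst z) * q (snd z)) * dword g (fst z @ snd z) x)"
    unfolding e by (subst MC_diff_sum) (auto simp: MC_diff_scale finite_supp_scale)
  also have "\<dots> = (\<lambda>x. (\<Sum>z\<in>?P \<times> ?Q. (p (fst z) * q (snd z)) * tmul (dword g (fst z)) (word (snd z)) x)
      + (\<Sum>z\<in>?P \<times> ?Q. (p (fst z) * q (snd z)) * (?s (fst z) * tmul (word (fst z)) (dword g (snd z)) x)))"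
    by (simp add: dword_append distrib_left sum.distrib)
  also have "(\<lambda>x. \<Sum>z\<in>?P \<times> ?Q. (p (fst z) * q (snd z)) * tmul (dword g (fst z)) (word (snd z)) x)
      = tmul (MC_diff g p) q"
    unfolding MC_diff_def
    by (subst (2) qe)
       (simp add: tmul_sum_left tmul_sum_right tmul_scale_left tmul_scale_right
          sum.cartesian_product case_prod_unfold sum_distrib_left mult.assoc)
  also have "(\<lambda>x. \<Sum>z\<in>?P \<times> ?Q. (p (fst z) * q (snd z)) * (?s (fst z) * tmul (word (fst z)) (dword g (snd z)) x))
      = tmul (\<lambda>u. ?s u * p u) (MC_diff g q)"
  proof -
    have e2: "(\<lambda>u. ?s u * p u) = (\<lambda>w. \<Sum>u\<in>?P. (?s u * p u) * word u w)"
      by (rule expand_words) (use p in auto)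
    show ?thesis
      unfolding MC_diff_def
      apply (subst e2)
      apply (simp add: tmul_sum_left tmul_sum_right tmul_scale_left tmul_scale_right
            sum.cartesian_product case_prod_unfold sum_distrib_left mult.assoc)
      apply (simp add: mult.left_commute)
      done
  qed
  finally show ?thesis .
qed

definition neg_count :: "'v rel \<Rightarrow> 'v list \<Rightarrow> nat" where
  "neg_count r is = card {(i, j). i < j \<and> j < length is \<and> (is ! j, is ! i) \<in> r}"

lemma neg_count_Cons:
  "neg_count r (x # xs) = length (filter (\<lambda>y. (y, x) \<in> r) xs) + neg_count r xs"
proof -
  let ?N = "{(i, j). i < j \<and> j < length xs \<and> (xs ! j, xs ! i) \<in> r}"
  let ?M = "{j. j < length xs \<and> (xs ! j, x) \<in> r}"
  have fin: "finite ?N"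
    by (rule finite_subset[of _ "{..<length xs} \<times> {..<length xs}"]) auto
  have "{(i, j). i < j \<and> j < length (x # xs) \<and> ((x # xs) ! j, (x # xs) ! i) \<in> r}
      = (\<lambda>j. (0, Suc j)) ` ?M \<union> (\<lambda>(i, j). (Suc i, Suc j)) ` ?N" (is "?L = ?R")
  proof
    show "?L \<subseteq> ?R"
    proof clarify
      fix i j assume h: "i < j" "j < length (x # xs)" "((x # xs) ! j, (x # xs) ! i) \<in> r"
        "(i, j) \<notin> (\<lambda>(i, j). (Suc i, Suc j)) ` ?N"
      then obtain j' where "j = Suc j'" by (cases j) auto
      with h show "(i, j) \<in> (\<lambda>j. (0, Suc j)) ` ?M" by (cases i) (auto simp: image_iff)
    qed
    show "?R \<subseteq> ?L" by auto
  qed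
  moreover have "card ((\<lambda>j. (0, Suc j)) ` ?M \<union> (\<lambda>(i, j). (Suc i, Suc j)) ` ?N)
      = card ((\<lambda>j. (0::nat, Suc j)) ` ?M) + card ((\<lambda>(i, j). (Suc i, Suc j)) ` ?N)"
    by (rule card_Un_disjoint) (use fin in auto)
  moreover have "card ((\<lambda>j. (0::nat, Suc j)) ` ?M) = card ?M"
    by (rule card_image) (auto simp: inj_on_def)
  moreover have "card ((\<lambda>(i, j). (Suc i, Suc j)) ` ?N) = card ?N"
    by (rule card_image) (auto simp: inj_on_def)
  moreover have "card ?M = length (filter (\<lambda>y. (y, x) \<in> r) xs)"
    by (simp add: length_filter_conv_card)
  ultimately show ?thesis by (simp add: neg_count_def)
qed

lemma neg_count_swap:
  assumes "antisym r" "total_on A r" "a \<in> A" "b \<in> A" "a \<noteq> b"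
  shows "(-1::real) ^ neg_count r (u @ [a, b] @ v) = - ((-1) ^ neg_count r (u @ [b, a] @ v))"
proof (induction u)
  case Nil
  have "(a, b) \<in> r \<longleftrightarrow> (b, a) \<notin> r" using assms by (auto simp: antisym_def total_on_def)
  thus ?case by (auto simp: neg_count_Cons power_add)
next
  case (Cons x u)
  thus ?case by (simp add: neg_count_Cons power_add)
qed

context
  fixes G :: "'v hypergraph" and r :: "'v rel" and A :: "('v + 'v set) graded_ops"
  assumes G: "hypergraph G" "finite_hypergraph G" and r: "linear_order_on (verts G) r"
    and A_eq: "A = hypergraph_algebra r G"
begin

lemma edge_facts: "I \<in> edges G \<Longrightarrow> I \<subseteq> verts G" "I \<in> edges G \<Longrightarrow> finite I" "I \<in> edges G \<Longrightarrow> I \<noteq> {}"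
  using G by (auto simp: edges_def hypergraph_def finite_hypergraph_def dest: finite_subset)
    (metis card.empty less_irrefl)

lemma finite_edges: "finite (edges G)"
  by (rule finite_subset[of _ "Pow (verts G)"]) (use edge_facts G in \<open>auto simp: finite_hypergraph_def\<close>)

lemma finite_basis: "finite (basis A)"
  using G finite_edges by (simp add: A_eq hypergraph_algebra_def finite_hypergraph_def)

lemma bracket_nonzero:
  assumes "bracket A bs c \<noteq> 0" "bs \<noteq> []"
  obtains "is" I where "bs = map Inl is" "c = Inr I" "distinct is" "set is = I" "I \<in> edges G"
    "card I = length is" "I \<subseteq> verts G"
proof -
  obtain I where c: "c = Inr I" using assms by (cases c) (auto simp: A_eq hypergraph_algebra_def)
  with assms have h: "bs \<in> lists (Inl ` verts G)" "I \<in> kedges G (length bs)"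
      "wedge_coeff r (map projl bs) I \<noteq> 0"
    by (auto simp: A_eq hypergraph_algebra_def split: if_splits)
  from h(1) have bs: "bs = map Inl (map projl bs)" by (induction bs) auto
  from h(3) have d: "distinct (map projl bs)" "set (map projl bs) = I"
    by (auto simp: wedge_coeff_def split: if_splits)
  have e: "I \<in> edges G" using h(2) assms(2) by (auto simp: edges_def)
  have "card I = length (map projl bs)" using distinct_card[OF d(1)] d(2) by simp
  thus ?thesis using that bs c d e edge_facts(1) by blast
qed

lemma finite_bracket: "finite {bs. bs \<noteq> [] \<and> bracket A bs c \<noteq> 0}"
proof (rule finite_subset)
  show "{bs. bs \<noteq> [] \<and> bracket A bs c \<noteq> 0}
      \<subseteq> map Inl ` {is. set is \<subseteq> verts G \<and> length is \<le> card (verts G)}"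
  proof clarify
    fix bs assume h: "bracket A bs c \<noteq> 0" "bs \<noteq> []"
    obtain "is" I where h: "bs = map Inl is" "c = Inr I" "distinct is" "set is = I" "I \<in> edges G"
      "card I = length is" "I \<subseteq> verts G" by (rule bracket_nonzero[OF h])
    moreover have "length is \<le> card (verts G)"
      using h G card_mono[of "verts G" I] by (simp add: finite_hypergraph_def)
    ultimately show "bs \<in> map Inl ` {is. set is \<subseteq> verts G \<and> length is \<le> card (verts G)}" by auto
  qed
  show "finite (map Inl ` {is. set is \<subseteq> verts G \<and> length is \<le> card (verts G)})"
    using G by (intro finite_imageI finite_lists_length_le) (simp add: finite_hypergraph_def)
qed

lemma dgen_nonzero:
  assumes "dgen A c w \<noteq> 0"
  obtains "is" I where "w = map Inl is" "c = Inr I" "distinct is" "set is = I" "I \<in> edges G"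
    "card I = length is" "I \<subseteq> verts G" "bracket A w c \<noteq> 0" "w \<noteq> []"
proof -
  have h: "bracket A w c \<noteq> 0" "w \<noteq> []"
    using assms by (auto simp: dgen_def form_tensor_def split: if_splits)
  show ?thesis by (rule bracket_nonzero[OF h]) (use that h in blast)
qed

lemma finite_dgen: "finite {w. dgen A c w \<noteq> 0}"
  by (rule finite_subset[OF _ finite_bracket[of c]]) (auto elim: dgen_nonzero)

lemma dgen_Inl: "dgen A (Inl i) = (\<lambda>_. 0)"
  by (rule ext, rule ccontr) (auto elim: dgen_nonzero)

lemma dword_Inl: "dword A (map Inl is) = (\<lambda>_. 0)"
  by (induction "is") (auto simp: dgen_Inl)

lemma sum_list_cdeg_Inl: "sum_list (map (cdeg A) (map Inl is)) = int (length is)"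
  by (induction "is") (auto simp: cdeg_def A_eq hypergraph_algebra_def)

lemma ksign_dgen:
  "ksign (sum_list (map (cdeg A) w)) * dgen A c w = - ksign (cdeg A c) * dgen A c w"
proof (cases "dgen A c w = 0")
  case False
  obtain "is" I where h: "w = map Inl is" "c = Inr I" "distinct is" "set is = I" "I \<in> edges G"
    "card I = length is" "I \<subseteq> verts G" "bracket A w c \<noteq> 0" "w \<noteq> []"
    by (rule dgen_nonzero[OF False])
  have "cdeg A c = int (length is) - 1" using h by (simp add: cdeg_def A_eq hypergraph_algebra_def)
  thus ?thesis using sum_list_cdeg_Inl[of "is"] h(1) by (simp add: ksign_def)
qed auto

lemma MC_diff_dgen: "MC_diff A (dgen A c) = (\<lambda>_. 0)"
proof
  fix u
  show "MC_diff A (dgen A c) u = 0"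
    unfolding MC_diff_def by (intro sum.neutral ballI) (auto elim!: dgen_nonzero simp: dword_Inl)
qed

lemma MC_diff_dword: "MC_diff A (dword A w) = (\<lambda>_. 0)"
proof (induction w)
  case Nil
  thus ?case by (simp add: MC_diff_def)
next
  case (Cons c w)
  note fin = finite_dgen
  note fins = fin finite_supp_word finite_supp_dword[OF fin]
  have "MC_diff A (dword A (c # w)) = (\<lambda>u. MC_diff A (tmul (dgen A c) (word w)) u
      + ksign (cdeg A c) * MC_diff A (tmul (word [c]) (dword A w)) u)"
    by (simp add: MC_diff_add MC_diff_scale fins finite_supp_tmul finite_supp_scale)
  moreover have "MC_diff A (tmul (dgen A c) (word w))
      = (\<lambda>u. - ksign (cdeg A c) * tmul (dgen A c) (dword A w) u)"
    by (simp only: MC_diff_tmul[OF fin fin finite_supp_word] MC_diff_dgen ksign_dgen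
        tmul_scale_left MC_diff_word tmul_zero) simp
  moreover have "MC_diff A (tmul (word [c]) (dword A w)) = tmul (dgen A c) (dword A w)"
    by (simp only: MC_diff_tmul[OF fin finite_supp_word finite_supp_dword[OF fin]] Cons.IH
        MC_diff_word tmul_zero) (simp add: tmul_zero)
  ultimately show ?case by simp
qed

lemma L_infinity_algebra_aux: "L_infinity_algebra A"
  unfolding L_infinity_algebra_def
proof (intro conjI allI ballI impI)
  fix n show "finite {b \<in> basis A. deg A b = n}" using finite_basis by simp
next
  have "\<forall>b\<in>basis A. Min (deg A ` basis A) \<le> deg A b" using finite_basis by simp
  thus "\<exists>m. \<forall>b\<in>basis A. m \<le> deg A b" by blast
next
  fix bs c assume h: "bs \<noteq> []" "bracket A bs c \<noteq> 0"
  obtain "is" I where h: "bs = map Inl is" "c = Inr I" "distinct is" "set is = I" "I \<in> edges G"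
      "card I = length is" "I \<subseteq> verts G" by (rule bracket_nonzero[OF h(2,1)])
  have "sum_list (map (deg A) (map Inl is)) = 0"
    by (induction "is") (auto simp: A_eq hypergraph_algebra_def)
  thus "deg A c = sum_list (map (deg A) bs) + 2 - int (length bs)"
    using h by (simp add: A_eq hypergraph_algebra_def)
next
  fix c show "finite {bs \<in> lists (basis A). bs \<noteq> [] \<and> bracket A bs c \<noteq> 0}"
    by (rule finite_subset[OF _ finite_bracket[of c]]) auto
next
  fix p assume "p \<in> tensors A"
  hence p: "finite {w. p w \<noteq> 0}" by (simp add: tensors_def)
  have "MC_diff A (MC_diff A p) = (\<lambda>_. 0)"
    unfolding MC_diff_def[of A p]
    by (subst MC_diff_sum)
       (simp_all add: MC_diff_scale finite_supp_scale finite_supp_dword[OF finite_dgen] MC_diff_dword)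
  thus "MC_diff A (MC_diff A p) \<in> koszul_ideal A" by (simp add: koszul_ideal.zero)
next
  fix c assume c: "c \<in> basis A"
  have r': "antisym r" "total_on (verts G) r"
    using r by (auto simp: linear_order_on_def partial_order_on_def)
  show "graded_antisym A (\<lambda>bs. bracket A bs c)"
    unfolding graded_antisym_def
  proof (intro ballI)
    fix u v a b
    show "bracket A (u @ [a, b] @ v) c
        = - ksign (deg A a * deg A b) * bracket A (u @ [b, a] @ v) c"
    proof (cases "u @ [a, b] @ v \<in> lists (Inl ` verts G) \<and> (\<exists>I. c = Inr I)")
      case False
      thus ?thesis by (cases c) (auto simp: A_eq hypergraph_algebra_def)
    next
      case True
      then obtain i j I where ab: "a = Inl i" "b = Inl j" "i \<in> verts G" "j \<in> verts G" "c = Inr I" by auto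
      let ?p = "map projl"
      have "wedge_coeff r (?p u @ [i, j] @ ?p v) I = - wedge_coeff r (?p u @ [j, i] @ ?p v) I"
      proof (cases "i = j")
        case True thus ?thesis by (simp add: wedge_coeff_def)
      next
        case False
        have "set (?p u @ [i, j] @ ?p v) = set (?p u @ [j, i] @ ?p v)" by auto
        moreover have "distinct (?p u @ [i, j] @ ?p v) = distinct (?p u @ [j, i] @ ?p v)" by auto
        ultimately show ?thesis
          using neg_count_swap[OF r' ab(3,4) False, of "?p u" "?p v"]
          unfolding wedge_coeff_def neg_count_def by (simp only: if_distrib) simp
      qed
      thus ?thesis using True ab by (simp add: A_eq hypergraph_algebra_def ksign_def)
    qed
  qed
qed

end

theorem L_infinity_algebra_hypergraph_algebra:
  assumes "hypergraph G" and "finite_hypergraph G" and "linear_order_on (verts G) r"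
  shows "L_infinity_algebra (hypergraph_algebra r G)"
  using L_infinity_algebra_aux[OF assms refl] .

end

theory Submission
  imports Defs "HOL-Combinatorics.Multiset_Permutations"
begin

text \<open>
  Coefficients of elements of \<open>Sym\<close> are read off by functionals on words that respect the Koszul
  signs, hence vanish on the ideal.  Writing a closed form as
  \<open>\<Sum> \<omega>\<^sub>i\<^sub>j x\<^sub>i x\<^sub>j + \<Sum> \<omega>\<^sub>i\<^sub>I x\<^sub>i x\<^sub>I + \<Sum> \<omega>\<^sub>I\<^sub>J x\<^sub>I x\<^sub>J\<close>, this gives \<open>\<omega>\<^sub>I\<^sub>J = 0\<close>,
  because the monomials \<open>d x\<^sub>I\<close> are linearly independent.  Then all remaining values are
  antisymmetric, so non-degeneracy forces an even number of generators.

  If Hall's condition failed, take a maximal set \<open>S\<close> of edges with \<open>card (\<Union>S) < card S\<close>.  By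
  maximality, closedness implies \<open>\<omega>\<^sub>i\<^sub>I = 0\<close> for all \<open>I \<in> S\<close> and \<open>i \<notin> \<Union>S\<close>.  So the
  columns of \<open>\<omega>\<close> in \<open>S\<close> live in the too few rows \<open>\<Union>S\<close> and are linearly dependent.

  Conversely, pair \<open>x\<^sub>I\<close> with the vertex representing \<open>I\<close>, and pair up the remaining
  vertices arbitrarily; the form is closed because \<open>x\<^sub>i d x\<^sub>I = 0\<close> for \<open>i \<in> I\<close>.
\<close>

section \<open>Hall's marriage theorem\<close>

text \<open>Rado's argument: a set with two elements can be shrunk without losing Hall's condition.
  Otherwise both removals make some family tight, and submodularity of the cardinality of unions
  yields a contradiction.\<close>

lemma hall_marriage:
  fixes N :: "'i \<Rightarrow> 'a set"
  assumes "finite J" "\<And>i. i \<in> J \<Longrightarrow> finite (N i)"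
    and "\<And>P. P \<subseteq> J \<Longrightarrow> card P \<le> card (\<Union>i\<in>P. N i)"
  shows "\<exists>f. inj_on f J \<and> (\<forall>i\<in>J. f i \<in> N i)"
  using assms(2,3)
proof (induction "\<Sum>i\<in>J. card (N i)" arbitrary: N rule: less_induct)
  case less
  note fin = less.prems(1) and hall = less.prems(2)
  show ?case
  proof (cases "\<exists>i\<in>J. \<exists>x\<in>N i. \<exists>y\<in>N i. x \<noteq> y")
    case False
    \<comment> \<open>No set has two elements here. Hall's condition for one and for two indices
      makes the sets nonempty and pairwise different.\<close>
    have ne: "N i \<noteq> {}" if "i \<in> J" for i using hall[of "{i}"] that by auto
    define f where "f i = (SOME x. x \<in> N i)" for i
    have f: "f i \<in> N i" if "i \<in> J" for i
      unfolding f_def using ne[OF that] by (simp add: some_in_eq)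
    have single: "N i = {f i}" if "i \<in> J" for i using f[OF that] False that by auto
    have "inj_on f J"
    proof (rule inj_onI, rule ccontr)
      fix i j assume h: "i \<in> J" "j \<in> J" "f i = f j" "i \<noteq> j"
      have "(\<Union>k\<in>{i, j}. N k) = {f i}" using single h by auto
      thus False using hall[of "{i, j}"] h by simp
    qed
    with f show ?thesis by blast
  next
    case True
    then obtain i x y where i: "i \<in> J" and xy: "x \<in> N i" "y \<in> N i" "x \<noteq> y" by blast
    have reduce: ?thesis
      if z: "z \<in> N i" and h: "\<And>P. P \<subseteq> J \<Longrightarrow> card P \<le> card (\<Union>k\<in>P. (N(i := N i - {z})) k)" for z
    proof -
      let ?N = "N(i := N i - {z})"
      have "(\<Sum>k\<in>J. card (?N k)) < (\<Sum>k\<in>J. card (N k))"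
      proof (rule sum_strict_mono_ex1)
        show "\<forall>k\<in>J. card (?N k) \<le> card (N k)" by (simp add: card_Diff1_le)
        show "\<exists>k\<in>J. card (?N k) < card (N k)"
          using card_Diff1_less[OF fin[OF i] z] i by (intro bexI[of _ i]) simp_all
      qed (rule assms(1))
      hence "\<exists>f. inj_on f J \<and> (\<forall>k\<in>J. f k \<in> ?N k)"
        by (rule less.hyps) (simp_all add: fin h del: fun_upd_apply, simp add: fin i)
      moreover have "?N k \<subseteq> N k" for k by simp
      ultimately show ?thesis by blast
    qed
    \<comment> \<open>A family violating the condition after the removal of \<open>z\<close> must
      contain \<open>i\<close>. Dropping \<open>i\<close> lowers its size by one, so the strict
      inequality becomes a weak one.\<close>
    have tight: "\<exists>P. P \<subseteq> J \<and> i \<notin> P \<and> card ((\<Union>k\<in>P. N k) \<union> (N i - {z})) \<le> card P"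
      if h: "P \<subseteq> J" "card (\<Union>k\<in>P. (N(i := N i - {z})) k) < card P" for P z
    proof -
      have "i \<in> P"
      proof (rule ccontr)
        assume "i \<notin> P"
        hence "(\<Union>k\<in>P. (N(i := N i - {z})) k) = (\<Union>k\<in>P. N k)" by auto
        thus False using h hall[of P] by simp
      qed
      hence "(\<Union>k\<in>P. (N(i := N i - {z})) k) = (\<Union>k\<in>P - {i}. N k) \<union> (N i - {z})"
        by (auto split: if_splits)
      moreover have "card P = Suc (card (P - {i}))"
        using card.remove[OF finite_subset[OF h(1) assms(1)] \<open>i \<in> P\<close>] .
      ultimately have "card ((\<Union>k\<in>P - {i}. N k) \<union> (N i - {z})) \<le> card (P - {i})"
        using h(2) by simp
      with h(1) show ?thesis by blast
    qed
    show ?thesis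
    proof (rule ccontr)
      assume no: "\<not> ?thesis"
      have tight': "\<exists>P. P \<subseteq> J \<and> i \<notin> P \<and> card ((\<Union>k\<in>P. N k) \<union> (N i - {z})) \<le> card P"
        if z: "z \<in> N i" for z
      proof -
        obtain P where P: "P \<subseteq> J" "\<not> card P \<le> card (\<Union>k\<in>P. (N(i := N i - {z})) k)"
          using reduce[OF z] no by blast
        thus ?thesis by (intro tight[of P]) (simp_all only: not_le)
      qed
      obtain P where P: "P \<subseteq> J" "i \<notin> P" "card ((\<Union>k\<in>P. N k) \<union> (N i - {x})) \<le> card P"
        using tight'[OF xy(1)] by blast
      obtain Q where Q: "Q \<subseteq> J" "i \<notin> Q" "card ((\<Union>k\<in>Q. N k) \<union> (N i - {y})) \<le> card Q"
        using tight'[OF xy(2)] by blast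
      let ?U = "(\<Union>k\<in>P. N k) \<union> (N i - {x})" and ?W = "(\<Union>k\<in>Q. N k) \<union> (N i - {y})"
      have finJ: "finite P" "finite Q" using P Q assms(1) finite_subset by blast+
      have finU: "finite ?U" "finite ?W" using finJ P Q fin i by auto
      \<comment> \<open>The extra 1 comes from inserting \<open>i\<close>, which lies in neither
        \<open>P\<close> nor \<open>Q\<close>. As \<open>x\<close> and \<open>y\<close> differ,
        \<open>?U\<close> and \<open>?W\<close> together cover all of \<open>N i\<close>.\<close>
      have "card P + card Q + 1 = card (P \<union> Q) + card (P \<inter> Q) + 1"
        using card_Un_Int[OF finJ] by simp
      also have "\<dots> = card (insert i (P \<union> Q)) + card (P \<inter> Q)" using finJ P Q by simp
      also have "\<dots> \<le> card (\<Union>k\<in>insert i (P \<union> Q). N k) + card (\<Union>k\<in>P \<inter> Q. N k)"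
        using P Q i by (intro add_mono hall) auto
      also have "\<dots> \<le> card (?U \<union> ?W) + card (?U \<inter> ?W)"
        using finU xy by (intro add_mono card_mono) auto
      also have "\<dots> = card ?U + card ?W" using card_Un_Int[OF finU] by simp
      finally show False using P Q by simp
    qed
  qed
qed

section \<open>Linear algebra: kernels and antisymmetric matrices\<close>

text \<open>Gaussian elimination: a nonzero row \<open>r\<close> with pivot \<open>p\<close> clears
  column \<open>p\<close> from the other rows, and a solution of the reduced system on
  \<open>S - {p}\<close> is extended to \<open>p\<close>.\<close>

lemma underdetermined_system:
  fixes B :: "'i \<Rightarrow> 'j \<Rightarrow> 'a::field"
  assumes "finite R" "finite S" "card R < card S"
  shows "\<exists>v. (\<exists>j\<in>S. v j \<noteq> 0) \<and> (\<forall>i\<in>R. (\<Sum>j\<in>S. v j * B i j) = 0)"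
  using assms
proof (induction R arbitrary: S B rule: finite_induct)
  case empty
  hence "S \<noteq> {}" by auto
  thus ?case by (intro exI[of _ "\<lambda>_. 1"]) auto
next
  case (insert r R)
  show ?case
  proof (cases "\<forall>j\<in>S. B r j = 0")
    case True
    from insert have "card R < card S" by simp
    from insert.IH[OF insert.prems(1) this, of B] obtain v
      where v: "\<exists>j\<in>S. v j \<noteq> 0" "\<forall>i\<in>R. (\<Sum>j\<in>S. v j * B i j) = 0" by blast
    have "(\<Sum>j\<in>S. v j * B r j) = 0" using True by simp
    with v show ?thesis by blast
  next
    case False
    then obtain p where p: "p \<in> S" "B r p \<noteq> 0" by blast
    have "card R < card (S - {p})" using insert p by simp
    from insert.IH[OF _ this, of "\<lambda>i j. B i j - B i p * B r j / B r p"] insert.prems(1)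
    obtain v where v: "\<exists>j\<in>S - {p}. v j \<noteq> 0"
      "\<And>i. i \<in> R \<Longrightarrow> (\<Sum>j\<in>S - {p}. v j * (B i j - B i p * B r j / B r p)) = 0" by auto
    define s where "s = (\<Sum>j\<in>S - {p}. v j * B r j)"
    \<comment> \<open>The value at \<open>p\<close> solves the equation of row \<open>r\<close>. The
      reduced row \<open>r\<close> is identically zero, so \<open>eq\<close> covers that row
      too.\<close>
    let ?v = "v(p := - s / B r p)"
    have eq: "(\<Sum>j\<in>S. ?v j * B i j) = (\<Sum>j\<in>S - {p}. v j * (B i j - B i p * B r j / B r p))" for i
    proof -
      have "(\<Sum>j\<in>S. ?v j * B i j) = - s / B r p * B i p + (\<Sum>j\<in>S - {p}. ?v j * B i j)"
        using insert.prems(1) p by (simp add: sum.remove)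
      also have "(\<Sum>j\<in>S - {p}. ?v j * B i j) = (\<Sum>j\<in>S - {p}. v j * B i j)"
        by (rule sum.cong) auto
      also have "- s / B r p * B i p = - (\<Sum>j\<in>S - {p}. v j * (B i p * B r j / B r p))"
        by (simp add: s_def sum_distrib_left sum_divide_distrib sum_negf mult_ac)
      finally show ?thesis by (simp add: right_diff_distrib sum_subtractf)
    qed
    have "(\<Sum>j\<in>S. ?v j * B i j) = 0" if "i \<in> insert r R" for i
      unfolding eq using that v(2) p by (cases "i = r") auto
    moreover have "\<exists>j\<in>S. ?v j \<noteq> 0" using v(1) by auto
    ultimately show ?thesis by blast
  qed
qed

text \<open>Indices \<open>p\<close>, \<open>q\<close> with \<open>M p q\<close> nonzero span a
  hyperbolic plane. Splitting it off leaves an antisymmetric non-degenerate form on two indices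
  fewer. Characteristic 0 makes the diagonal vanish.\<close>

lemma nondegenerate_antisymmetric_imp_even_card:
  fixes M :: "'i \<Rightarrow> 'i \<Rightarrow> 'a::field_char_0"
  assumes "finite S" "\<And>a b. a \<in> S \<Longrightarrow> b \<in> S \<Longrightarrow> M a b = - M b a"
    and "\<And>v. (\<And>b. b \<in> S \<Longrightarrow> (\<Sum>a\<in>S. v a * M a b) = 0) \<Longrightarrow> (\<And>a. a \<in> S \<Longrightarrow> v a = 0)"
  shows "even (card S)"
  using assms
proof (induction "card S" arbitrary: S M rule: less_induct)
  case less
  note fin = less.prems(1) and anti = less.prems(2) and nondeg = less.prems(3)
  show ?case
  proof (cases "S = {}")
    case False
    then obtain p where p: "p \<in> S" by blast
    have "\<exists>q\<in>S. M p q \<noteq> 0"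
    proof (rule ccontr)
      assume "\<not> ?thesis"
      hence "(\<Sum>a\<in>S. (if a = p then 1 else 0) * M a b) = 0" if "b \<in> S" for b
        using that by (intro sum.neutral) auto
      from nondeg[OF this p] show False by simp
    qed
    then obtain q where q: "q \<in> S" "M p q \<noteq> 0" by blast
    define m where "m = M p q"
    have m: "m \<noteq> 0" "M p q = m" "M q p = - m" using q anti[OF q(1) p] by (auto simp: m_def)
    have diag: "M a a = 0" if "a \<in> S" for a using anti[OF that that] by simp
    have pq: "p \<noteq> q" using diag[OF p] q by auto
    let ?S = "S - {p, q}"
    have card: "card S = card ?S + 2"
      using fin p q pq card_Diff_subset[of "{p, q}" S] card_mono[OF fin, of "{p, q}"] by simp
    text \<open>\<open>M'\<close> is the restriction of the form to the orthogonal complement of \<open>p, q\<close>.\<close>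
    define M' where "M' a b = M a b - M a q * M p b / m + M a p * M q b / m" for a b
    have "even (card ?S)"
    proof (rule less.hyps)
      show "card ?S < card S" using card by simp
      show "finite ?S" using fin by simp
      fix a b assume "a \<in> ?S" "b \<in> ?S"
      hence "M a b = - M b a" "M a q = - M q a" "M p b = - M b p" "M a p = - M p a" "M q b = - M b q"
        using p q(1) by (auto intro!: anti)
      thus "M' a b = - M' b a" by (simp add: M'_def mult.commute)
    next
      fix v a assume v: "\<And>b. b \<in> ?S \<Longrightarrow> (\<Sum>a\<in>?S. v a * M' a b) = 0" and a: "a \<in> ?S"
      define s where "s = (\<Sum>a\<in>?S. v a * M a q)"
      define t where "t = (\<Sum>a\<in>?S. v a * M a p)"
      \<comment> \<open>The two new coefficients make \<open>?v\<close> orthogonal to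
        \<open>p\<close> and \<open>q\<close>: the pairings become \<open>t - t\<close> and
        \<open>s - s\<close>.\<close>
      let ?v = "v(p := - s / m, q := t / m)"
      have "(\<Sum>a\<in>S. ?v a * M a b) = 0" if b: "b \<in> S" for b
      proof -
        have "(\<Sum>a\<in>S. ?v a * M a b) = ?v p * M p b + (?v q * M q b + (\<Sum>a\<in>S - {p} - {q}. ?v a * M a b))"
          by (subst sum.remove[OF fin p], subst sum.remove[of "S - {p}" q]) (use fin q(1) pq in auto)
        also have "S - {p} - {q} = ?S" by auto
        also have "?v p * M p b + (?v q * M q b + (\<Sum>a\<in>?S. ?v a * M a b))
            = - s / m * M p b + (t / m * M q b + (\<Sum>a\<in>?S. ?v a * M a b))" using pq by simp
        also have "(\<Sum>a\<in>?S. ?v a * M a b) = (\<Sum>a\<in>?S. v a * M a b)"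
          by (rule sum.cong) auto
        also have "- s / m * M p b + (t / m * M q b + (\<Sum>a\<in>?S. v a * M a b)) = (\<Sum>a\<in>?S. v a * M' a b)"
        proof -
          have "(\<Sum>a\<in>?S. v a * M' a b) = (\<Sum>a\<in>?S. v a * M a b)
              - (\<Sum>a\<in>?S. v a * M a q) * (M p b / m) + (\<Sum>a\<in>?S. v a * M a p) * (M q b / m)"
            by (simp add: M'_def algebra_simps sum.distrib sum_subtractf sum_distrib_left)
          thus ?thesis by (simp add: s_def t_def)
        qed
        also have "\<dots> = 0"
        proof (cases "b \<in> ?S")
          case False
          have "M' a b = 0" if "a \<in> ?S" for a
            using False b m diag p q by (auto simp: M'_def)
          thus ?thesis by simp
        qed (rule v)
        finally show ?thesis .
      qed
      from nondeg[OF this, of a] a show "v a = 0" by auto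
    qed
    thus ?thesis using card by simp
  qed simp
qed

section \<open>Linear functionals on words and the Koszul ideal\<close>

text \<open>The linear extension of \<open>c\<close> to tensors. A sum over an infinite support is 0
  by convention, so the linearity lemmas ask for finite supports.\<close>

definition eval_words :: "('b list \<Rightarrow> real) \<Rightarrow> ('b list \<Rightarrow> real) \<Rightarrow> real" where
  "eval_words c p = (\<Sum>w | p w \<noteq> 0. p w * c w)"

lemma eval_words_superset:
  assumes "finite S" "{w. p w \<noteq> 0} \<subseteq> S"
  shows "eval_words c p = (\<Sum>w\<in>S. p w * c w)"
  unfolding eval_words_def using assms by (intro sum.mono_neutral_left) auto

lemma eval_words_add:
  assumes "finite {w. p w \<noteq> 0}" "finite {w. q w \<noteq> 0}"
  shows "eval_words c (\<lambda>w. p w + q w) = eval_words c p + eval_words c q"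
proof -
  let ?S = "{w. p w \<noteq> 0} \<union> {w. q w \<noteq> 0}"
  have "finite ?S" using assms by simp
  moreover have "{w. p w + q w \<noteq> 0} \<subseteq> ?S" by auto
  ultimately show ?thesis
    by (subst (1 2 3) eval_words_superset[of ?S]) (auto simp: distrib_right sum.distrib)
qed

lemma eval_words_scale:
  assumes "finite {w. p w \<noteq> 0}"
  shows "eval_words c (\<lambda>w. k * p w) = k * eval_words c p"
  using assms
  by (subst (1 2) eval_words_superset[of "{w. p w \<noteq> 0}"]) (auto simp: sum_distrib_left mult_ac)

lemma eval_words_word [simp]: "eval_words c (word u) = c u"
  by (subst eval_words_superset[of "{u}"]) (auto simp: word_def)

lemma eval_words_sum:
  assumes "\<And>a. a \<in> A \<Longrightarrow> finite {w. p a w \<noteq> 0}"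
  shows "finite {w. (\<Sum>a\<in>A. p a w) \<noteq> 0}"
    and "eval_words c (\<lambda>w. \<Sum>a\<in>A. p a w) = (\<Sum>a\<in>A. eval_words c (p a))"
proof -
  have "finite {w. (\<Sum>a\<in>A. p a w) \<noteq> 0} \<and>
      eval_words c (\<lambda>w. \<Sum>a\<in>A. p a w) = (\<Sum>a\<in>A. eval_words c (p a))"
    using assms
  proof (induction A rule: infinite_finite_induct)
    case (insert a A)
    have p: "finite {w. p a w \<noteq> 0}" and A: "finite {w. (\<Sum>a\<in>A. p a w) \<noteq> 0}"
      using insert by simp_all
    show ?case
      using insert finite_supp_add[OF p A] eval_words_add[OF p A, of c] by simp
  qed (simp_all add: eval_words_def)
  thus "finite {w. (\<Sum>a\<in>A. p a w) \<noteq> 0}"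
    "eval_words c (\<lambda>w. \<Sum>a\<in>A. p a w) = (\<Sum>a\<in>A. eval_words c (p a))" by auto
qed

text \<open>The functionals on words that descend to the quotient by
  \<open>koszul_ideal\<close>.\<close>

definition koszul_symmetric :: "('b, 'm) graded_ops_scheme \<Rightarrow> ('b list \<Rightarrow> real) \<Rightarrow> bool" where
  "koszul_symmetric g c \<longleftrightarrow>
     (\<forall>u\<in>lists (basis g). \<forall>v\<in>lists (basis g). \<forall>a\<in>basis g. \<forall>b\<in>basis g.
        c (u @ [a, b] @ v) = ksign (cdeg g a * cdeg g b) * c (u @ [b, a] @ v))"

text \<open>On the generators this is the definition of \<open>koszul_symmetric\<close>. Finiteness
  of supports is carried through the induction because additivity of \<open>eval_words\<close> rests
  on it.\<close>

lemma eval_words_koszul_ideal: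
  assumes "p \<in> koszul_ideal g" "koszul_symmetric g c"
  shows "eval_words c p = 0"
proof -
  have "finite {w. p w \<noteq> 0} \<and> eval_words c p = 0"
    using assms(1)
  proof induction
    case zero
    show ?case by (simp add: eval_words_def)
  next
    case (add p q)
    hence fin: "finite {w. p w \<noteq> 0}" "finite {w. q w \<noteq> 0}" by blast+
    show ?case using finite_supp_add[OF fin] eval_words_add[OF fin, of c] add.IH by simp
  next
    case (scale p k)
    hence fin: "finite {w. p w \<noteq> 0}" by blast
    show ?case using finite_supp_scale[OF fin, of k] eval_words_scale[OF fin, of c k] scale.IH by simp
  next
    case (comm u v a b)
    let ?k = "- ksign (cdeg g a * cdeg g b)"
    let ?p = "word (u @ [a, b] @ v)" and ?q = "word (u @ [b, a] @ v)"
    have eq: "(\<lambda>w. ?p w - ksign (cdeg g a * cdeg g b) * ?q w) = (\<lambda>w. ?p w + ?k * ?q w)" by simp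
    have c: "c (u @ [a, b] @ v) = - ?k * c (u @ [b, a] @ v)"
      using assms(2) comm unfolding koszul_symmetric_def minus_minus by blast
    note fin = finite_supp_word finite_supp_scale[OF finite_supp_word]
    show ?case
      unfolding eq eval_words_add[OF fin] eval_words_scale[OF finite_supp_word] eval_words_word c
      using finite_supp_add[OF fin, of "u @ [a, b] @ v" ?k "u @ [b, a] @ v"] by simp
  qed
  thus ?thesis by simp
qed

lemma ksign_simps: "ksign (m + n) = ksign m * ksign n" "ksign m * ksign m = 1" "ksign 0 = 1"
  "ksign (1 - m) = - ksign m"
  by (auto simp: ksign_def)

text \<open>The letter \<open>b\<close> passes the letters of \<open>w\<close> one at a time, which
  relates \<open>dx_a x_b\<close> to \<open>x_b dx_a\<close>. The prefix \<open>u\<close> absorbs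
  the letters already treated.\<close>

lemma koszul_symmetric_rotate:
  assumes c: "koszul_symmetric g c" and b: "b \<in> basis g" and w: "w \<in> lists (basis g)"
    and u: "u \<in> lists (basis g)"
  shows "c (u @ w @ [b]) = ksign (cdeg g b * sum_list (map (cdeg g) w)) * c (u @ b # w)"
  using w u
proof (induction w arbitrary: u)
  case (Cons a w)
  from Cons.IH[of "u @ [a]"] Cons.prems Cons.hyps
  have "c (u @ (a # w) @ [b]) = ksign (cdeg g b * sum_list (map (cdeg g) w)) * c (u @ [a, b] @ w)"
    by simp
  also have "c (u @ [a, b] @ w) = ksign (cdeg g a * cdeg g b) * c (u @ [b, a] @ w)"
    using c Cons.prems Cons.hyps b unfolding koszul_symmetric_def by blast
  finally show ?case by (simp add: ksign_simps distrib_left mult_ac)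
qed (simp add: ksign_simps)

lemma eval_words_tmul_word:
  assumes "finite {w. p w \<noteq> 0}"
  shows "eval_words c (tmul (word u) p) = (\<Sum>w | p w \<noteq> 0. p w * c (u @ w))"
    and "eval_words c (tmul p (word u)) = (\<Sum>w | p w \<noteq> 0. p w * c (w @ u))"
proof -
  note e = expand_words[OF assms subset_refl]
  show "eval_words c (tmul (word u) p) = (\<Sum>w | p w \<noteq> 0. p w * c (u @ w))"
    by (subst e) (simp add: tmul_sum_right tmul_scale_right tmul_word eval_words_sum
        finite_supp_scale eval_words_scale)
  show "eval_words c (tmul p (word u)) = (\<Sum>w | p w \<noteq> 0. p w * c (w @ u))"
    by (subst e) (simp add: tmul_sum_left tmul_scale_left tmul_word eval_words_sum
        finite_supp_scale eval_words_scale)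
qed

section \<open>The differential of a two-form\<close>

lemma MC_diff_form2:
  assumes "finite (basis g)"
  shows "MC_diff g (form_tensor g 2 (\<lambda>w. \<omega> (w ! 0) (w ! 1)))
    = (\<lambda>u. \<Sum>(a, b)\<in>basis g \<times> basis g. ksign (deg g a) * \<omega> a b / 2 * dword g [a, b] u)"
proof -
  let ?B = "basis g \<times> basis g" and ?t = "form_tensor g 2 (\<lambda>w. \<omega> (w ! 0) (w ! 1))"
  let ?l = "\<lambda>(a, b). [a, b]"
  have "{w. ?t w \<noteq> 0} \<subseteq> ?l ` ?B"
  proof
    fix w assume "w \<in> {w. ?t w \<noteq> 0}"
    hence "length w = 2" "w \<in> lists (basis g)" by (auto simp: form_tensor_def split: if_splits)
    thus "w \<in> ?l ` ?B" by (auto simp: length_Suc_conv numeral_2_eq_2 image_iff)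
  qed
  moreover have "finite (?l ` ?B)" using assms by simp
  moreover have "?t [a, b] = ksign (deg g a) * \<omega> a b / 2" if "a \<in> basis g" "b \<in> basis g" for a b
    using that by (simp add: form_tensor_def numeral_2_eq_2 lessThan_Suc)
  moreover have "inj_on ?l ?B" by (auto simp: inj_on_def)
  ultimately show ?thesis
    by (subst MC_diff_superset[of "?l ` ?B"]) (auto simp: sum.reindex intro!: ext sum.cong)
qed

text \<open>The derivation rule splits \<open>d(x_a x_b)\<close> into \<open>dx_a x_b\<close> and
  \<open>x_a dx_b\<close>. Graded antisymmetry of \<omega> makes the two resulting sums equal after
  exchanging \<open>a\<close> and \<open>b\<close>, which cancels the factor 1/2.\<close>

lemma closed_form_constraint:
  assumes fin: "finite (basis g)" "\<And>a. finite {w. dgen g a w \<noteq> 0}"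
    and supp: "\<And>a w. dgen g a w \<noteq> 0 \<Longrightarrow>
      w \<in> lists (basis g) \<and> sum_list (map (cdeg g) w) = cdeg g a + 1"
    and anti: "\<And>a b. a \<in> basis g \<Longrightarrow> b \<in> basis g \<Longrightarrow> \<omega> a b = - ksign (deg g a * deg g b) * \<omega> b a"
    and closed: "MC_diff g (form_tensor g 2 (\<lambda>w. \<omega> (w ! 0) (w ! 1))) \<in> koszul_ideal g"
    and c: "koszul_symmetric g c"
  shows "(\<Sum>(a, b)\<in>basis g \<times> basis g. \<omega> b a * (\<Sum>w | dgen g a w \<noteq> 0. dgen g a w * c (b # w))) = 0"
proof -
  let ?B = "basis g"
  define F where "F b a = (\<Sum>w | dgen g a w \<noteq> 0. dgen g a w * c (b # w))" for a b
  have F1: "eval_words c (tmul (word [b]) (dgen g a)) = F b a" for a b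
    by (simp add: eval_words_tmul_word fin F_def)
  \<comment> \<open>By \<open>supp\<close>, all words of \<open>dx_a\<close> have degree
    \<open>cdeg g a + 1\<close>, so the rotation sign is the same for each of them.\<close>
  have F2: "eval_words c (tmul (dgen g a) (word [b])) = ksign (cdeg g b * (cdeg g a + 1)) * F b a"
    if "b \<in> ?B" for a b
  proof -
    have "dgen g a w * c (w @ [b]) = ksign (cdeg g b * (cdeg g a + 1)) * (dgen g a w * c (b # w))"
      if w: "dgen g a w \<noteq> 0" for w
      using koszul_symmetric_rotate[OF c \<open>b \<in> ?B\<close>, of w "[]"] supp[OF w] by simp
    thus ?thesis
      by (auto simp: eval_words_tmul_word(2)[OF fin(2)] F_def sum_distrib_left intro!: sum.cong)
  qed
  have "0 = eval_words c (MC_diff g (form_tensor g 2 (\<lambda>w. \<omega> (w ! 0) (w ! 1))))"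
    using eval_words_koszul_ideal[OF closed c] by simp
  also have "\<dots> = (\<Sum>(a, b)\<in>?B \<times> ?B. ksign (deg g a) * \<omega> a b / 2 * eval_words c (dword g [a, b]))"
  proof -
    have fd: "finite {u. dword g w u \<noteq> 0}" for w by (intro finite_supp_dword fin)
    show ?thesis
      unfolding MC_diff_form2[OF fin(1)] case_prod_unfold
      by (simp only: eval_words_sum(2)[OF finite_supp_scale[OF fd]] eval_words_scale[OF fd])
  qed
  also have "\<dots> = (\<Sum>(a, b)\<in>?B \<times> ?B. - (\<omega> b a * F b a) / 2 + - (\<omega> a b * F a b) / 2)"
  proof (rule sum.cong[OF refl], clarify)
    fix a b assume ab: "a \<in> ?B" "b \<in> ?B"
    have "eval_words c (dword g [a, b]) = ksign (cdeg g b * (cdeg g a + 1)) * F b a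
        + ksign (cdeg g a) * F a b"
      by (simp add: eval_words_add eval_words_scale finite_supp_scale finite_supp_tmul fin F1 F2 ab)
    thus "ksign (deg g a) * \<omega> a b / 2 * eval_words c (dword g [a, b])
        = - (\<omega> b a * F b a) / 2 + - (\<omega> a b * F a b) / 2"
      using anti[OF ab] by (auto simp: ksign_def cdeg_def algebra_simps)
  qed
  also have "\<dots> = (\<Sum>(a, b)\<in>?B \<times> ?B. - (\<omega> b a * F b a) / 2) + (\<Sum>(a, b)\<in>?B \<times> ?B. - (\<omega> a b * F a b) / 2)"
    by (simp only: case_prod_unfold sum.distrib)
  also have "(\<Sum>(a, b)\<in>?B \<times> ?B. - (\<omega> a b * F a b) / 2) = (\<Sum>(a, b)\<in>?B \<times> ?B. - (\<omega> b a * F b a) / 2)"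
    by (rule sum.reindex_bij_witness[of _ "\<lambda>(a, b). (b, a)" "\<lambda>(a, b). (b, a)"]) auto
  also have "(\<Sum>(a, b)\<in>?B \<times> ?B. - (\<omega> b a * F b a) / 2) + (\<Sum>(a, b)\<in>?B \<times> ?B. - (\<omega> b a * F b a) / 2)
      = - (\<Sum>(a, b)\<in>?B \<times> ?B. \<omega> b a * F b a)"
    by (simp add: case_prod_unfold sum_negf sum_divide_distrib[symmetric])
  finally show ?thesis by (simp add: F_def)
qed

section \<open>Membership in the Koszul ideal\<close>

lemma koszul_ideal_sum:
  "(\<And>a. a \<in> A \<Longrightarrow> p a \<in> koszul_ideal g) \<Longrightarrow> (\<lambda>w. \<Sum>a\<in>A. p a w) \<in> koszul_ideal g"
  by (induction A rule: infinite_finite_induct) (auto intro: koszul_ideal.zero koszul_ideal.add)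

text \<open>Koszul moves bring the two odd letters together, and \<open>a a\<close> is half the
  graded commutator of \<open>a\<close> with itself.\<close>

lemma word_repeated_in_koszul_ideal:
  assumes a: "a \<in> basis g" "odd (cdeg g a)"
    and "u \<in> lists (basis g)" "v \<in> lists (basis g)" "z \<in> lists (basis g)"
  shows "word (u @ a # v @ a # z) \<in> koszul_ideal g"
  using assms(4,3,5)
proof (induction v arbitrary: u)
  case Nil
  have "(\<lambda>w. word (u @ [a, a] @ z) w - ksign (cdeg g a * cdeg g a) * word (u @ [a, a] @ z) w)
      \<in> koszul_ideal g" using Nil a by (intro koszul_ideal.comm) auto
  from koszul_ideal.scale[OF this, of "1/2"] show ?case using a by (simp add: ksign_def)
next
  case (Cons b v)
  let ?k = "ksign (cdeg g a * cdeg g b)"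
  have "word ((u @ [b]) @ a # v @ a # z) \<in> koszul_ideal g" using Cons by (intro Cons.IH) auto
  hence 1: "word (u @ [b, a] @ v @ a # z) \<in> koszul_ideal g" by simp
  have "(\<lambda>w. word (u @ [a, b] @ v @ a # z) w - ?k * word (u @ [b, a] @ v @ a # z) w)
      \<in> koszul_ideal g" using Cons a by (intro koszul_ideal.comm) auto
  from koszul_ideal.add[OF this koszul_ideal.scale[OF 1, of ?k]] show ?case by simp
qed


section \<open>Forms given by a matching\<close>

text \<open>The standard symplectic matrix of the matching of \<open>a\<close> with
  \<open>h a\<close>. The first two branches cannot clash when \<open>P\<close> is disjoint from its
  image.\<close>

definition pairing_form :: "'b set \<Rightarrow> ('b \<Rightarrow> 'b) \<Rightarrow> 'b \<Rightarrow> 'b \<Rightarrow> real" where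
  "pairing_form P h a b =
     (if a \<in> P \<and> b = h a then 1 else if b \<in> P \<and> a = h b then -1 else 0)"

text \<open>Each column has exactly one nonzero entry, in the row of the partner, so each equation
  kills one coordinate.\<close>

lemma nondegenerate_pairing_form:
  assumes h: "inj_on h P" "P \<inter> h ` P = {}" and B: "basis g = P \<union> h ` P"
  shows "nondegenerate_form g (pairing_form P h)"
  unfolding nondegenerate_form_def
proof (intro allI impI)
  fix v a
  assume v: "finite {a. v a \<noteq> 0} \<and> {a. v a \<noteq> 0} \<subseteq> basis g \<and>
    (\<forall>b\<in>basis g. (\<Sum>a | v a \<noteq> 0. v a * pairing_form P h a b) = 0)"
  have pick: "v a = 0" if b: "b \<in> basis g" "s \<noteq> 0"
    and e: "\<And>x. pairing_form P h x b = (if x = a then s else 0)" for a b s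
  proof -
    have "0 = (\<Sum>x | v x \<noteq> 0. v x * pairing_form P h x b)" using v b(1) by simp
    also have "\<dots> = (\<Sum>x | v x \<noteq> 0. if x = a then v a * s else 0)"
      by (rule sum.cong) (auto simp: e)
    also have "\<dots> = v a * s" using v by (simp add: sum.delta)
    finally show ?thesis using b(2) by simp
  qed
  show "v a = 0"
  proof (cases "a \<in> basis g")
    case True
    then consider "a \<in> P" | c where "c \<in> P" "a = h c" using B by auto
    thus ?thesis
    proof cases
      case 1
      show ?thesis
        by (rule pick[of "h a" 1]) (use 1 h B in \<open>auto simp: pairing_form_def dest: inj_onD\<close>)
    next
      case 2
      show ?thesis
        by (rule pick[of c "-1"]) (use 2 h B in \<open>auto simp: pairing_form_def\<close>)
    qed
  qed (use v in auto)
qed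

lemma even_card_pairing:
  assumes "finite R" "even (card R)"
  obtains X g where "X \<subseteq> R" "inj_on g X" "g ` X = R - X"
proof -
  obtain X where X: "X \<subseteq> R" "card X = card R div 2"
    by (meson obtain_subset_with_card_n div_le_dividend)
  have fin: "finite X" "finite (R - X)" using X assms finite_subset by auto
  have "card (R - X) = card X" using X assms fin by (auto simp: card_Diff_subset elim!: evenE)
  then obtain g where "bij_betw g X (R - X)" using fin finite_same_card_bij by metis
  thus ?thesis using that X by (auto simp: bij_betw_def)
qed

section \<open>Coefficient functionals for the hypergraph algebra\<close>

text \<open>
  The coefficient of \<open>x\<^sub>T x\<^sub>K\<close> in a word, for a product \<open>x\<^sub>T\<close> of at most one generator of
  edge type: \<open>e\<close> is the degree of that generator, which has to be moved past the
  vertex generators in front of it.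
\<close>

definition word_coeff :: "'v rel \<Rightarrow> int \<Rightarrow> 'v set list \<Rightarrow> 'v set \<Rightarrow> ('v + 'v set) list \<Rightarrow> real" where
  "word_coeff r e T K w =
     (if map projr (filter (\<lambda>x. \<not> isl x) w) = T
      then ksign (e * int (length (takeWhile isl w))) * wedge_coeff r (map projl (filter isl w)) K
      else 0)"

lemma wedge_coeff_neg_count:
  "wedge_coeff r is I = (if distinct is \<and> set is = I then (-1) ^ neg_count r is else 0)"
  by (simp add: wedge_coeff_def neg_count_def)

lemma wedge_coeff_swap:
  assumes "antisym r" "total_on V r" "i \<in> V" "j \<in> V"
  shows "wedge_coeff r (u @ [i, j] @ v) I = - wedge_coeff r (u @ [j, i] @ v) I"
proof (cases "i = j")
  case False
  have "set (u @ [i, j] @ v) = set (u @ [j, i] @ v)" by auto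
  moreover have "distinct (u @ [i, j] @ v) = distinct (u @ [j, i] @ v)" by auto
  ultimately show ?thesis
    using neg_count_swap[OF assms False, of u v] unfolding wedge_coeff_neg_count by (simp only: if_distrib) simp
qed (simp add: wedge_coeff_def)

text \<open>The sign of the ordering \<open>is\<close> occurs in both factors and cancels. The
  remaining sign counts the vertices of \<open>I\<close> preceding \<open>i\<close>.\<close>

lemma wedge_coeff_Cons:
  assumes "distinct is" "set is = I"
  shows "wedge_coeff r (i # is) K * wedge_coeff r is I =
    (if i \<notin> I \<and> insert i I = K then (-1) ^ card {y \<in> I. (y, i) \<in> r} else 0)"
proof -
  have "length (filter (\<lambda>y. (y, i) \<in> r) is) = card {y \<in> I. (y, i) \<in> r}"
    using distinct_length_filter[OF assms(1)] assms(2) by (simp add: Int_def conj_commute)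
  thus ?thesis
    using assms by (simp add: wedge_coeff_neg_count neg_count_Cons power_add power_mult_distrib[symmetric])
qed

context
  fixes G :: "'v hypergraph" and r :: "'v rel" and A :: "('v + 'v set) graded_ops"
  assumes G: "hypergraph G" "finite_hypergraph G" and r: "linear_order_on (verts G) r"
    and A_eq: "A = hypergraph_algebra r G"
begin

lemmas edge_props = edge_facts[OF G r A_eq]
lemmas fin_edges = finite_edges[OF G r A_eq]
lemmas fin_basis = finite_basis[OF G r A_eq]
lemmas fin_dgen = finite_dgen[OF G r A_eq]
lemmas dgen_vertex = dgen_Inl[OF G r A_eq]

lemma basis_eq: "basis A = Inl ` verts G \<union> Inr ` edges G"
  by (simp add: A_eq hypergraph_algebra_def)

lemma deg_simps: "deg A (Inl i) = 0" "deg A (Inr I) = 2 - int (card I)"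
    "cdeg A (Inl i) = 1" "cdeg A (Inr I) = int (card I) - 1"
  by (simp_all add: A_eq hypergraph_algebra_def cdeg_def)

lemma edge_kedges: "I \<in> edges G \<Longrightarrow> I \<in> kedges G (card I)"
  using G by (auto simp: edges_def hypergraph_def)

lemma dgen_support:
  assumes "dgen A a w \<noteq> 0"
  shows "w \<in> lists (basis A) \<and> sum_list (map (cdeg A) w) = cdeg A a + 1"
proof -
  obtain "is" I where h: "w = map Inl is" "a = Inr I" "set is = I" "card I = length is" "I \<subseteq> verts G"
    by (rule dgen_nonzero[OF G r A_eq assms]) blast
  have "sum_list (map (cdeg A) (map Inl is)) = int (length is)"
    by (rule sum_list_cdeg_Inl[OF G r A_eq])
  thus ?thesis using h by (auto simp: basis_eq deg_simps intro!: imageI)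
qed

text \<open>As a tensor, \<open>dx_I\<close> is the signed average over all orderings of
  \<open>I\<close>. Vertices have degree 0, so the decalage sign is trivial.\<close>

lemma dgen_edge_sum:
  assumes I: "I \<in> edges G"
  shows "(\<Sum>w | dgen A (Inr I) w \<noteq> 0. dgen A (Inr I) w * h w)
    = (\<Sum>is\<in>permutations_of_set I. wedge_coeff r is I / fact (card I) * h (map Inl is))"
proof -
  let ?S = "map Inl ` permutations_of_set I :: ('v + 'v set) list set"
  have "{w. dgen A (Inr I) w \<noteq> 0} \<subseteq> ?S"
    by (auto elim!: dgen_nonzero[OF G r A_eq] simp: permutations_of_set_def)
  hence "(\<Sum>w | dgen A (Inr I) w \<noteq> 0. dgen A (Inr I) w * h w) = (\<Sum>w\<in>?S. dgen A (Inr I) w * h w)"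
    by (intro sum.mono_neutral_left) auto
  also have "\<dots> = (\<Sum>is\<in>permutations_of_set I. dgen A (Inr I) (map Inl is) * h (map Inl is))"
    by (subst sum.reindex) (auto simp: inj_on_def inj_map_eq_map)
  also have "\<dots> = (\<Sum>is\<in>permutations_of_set I. wedge_coeff r is I / fact (card I) * h (map Inl is))"
  proof (rule sum.cong[OF refl])
    fix "is" assume "is \<in> permutations_of_set I"
    hence iss: "distinct is" "set is = I" by (auto simp: permutations_of_set_def)
    have len: "length is = card I" using iss distinct_card by fastforce
    have Vs: "map Inl is \<in> lists (Inl ` verts G :: ('v + 'v set) set)" using iss edge_props(1)[OF I] by (auto intro!: imageI)
    have ne: "is \<noteq> []" using iss edge_props(3)[OF I] by auto
    have "bracket A (map Inl is) (Inr I) = wedge_coeff r is I"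
      using Vs edge_kedges[OF I] len by (simp add: A_eq hypergraph_algebra_def comp_def)
    moreover have "map Inl is \<in> lists (basis A)" using Vs by (auto simp: basis_eq)
    moreover have "(\<Sum>i<length is. (int (length is) - 1 - int i) * deg A (map Inl is ! i)) = 0"
      by (rule sum.neutral) (auto simp: deg_simps)
    ultimately have "dgen A (Inr I) (map Inl is) = wedge_coeff r is I / fact (card I)"
      using ne len by (simp add: dgen_def form_tensor_def ksign_simps)
    thus "dgen A (Inr I) (map Inl is) * h (map Inl is)
        = wedge_coeff r is I / fact (card I) * h (map Inl is)" by simp
  qed
  finally show ?thesis .
qed

text \<open>Swapping two vertices changes the sign of the wedge product. Swapping a vertex with the
  edge letter changes the \<open>takeWhile\<close> prefix by one, giving the sign of
  \<open>e\<close>. Two edge letters are too many for \<open>T\<close>, so both sides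
  vanish.\<close>

lemma koszul_symmetric_word_coeff:
  assumes T: "T = [] \<or> (\<exists>J. T = [J] \<and> e = cdeg A (Inr J))"
  shows "koszul_symmetric A (word_coeff r e T K)"
  unfolding koszul_symmetric_def
proof (intro ballI)
  fix u v a b
  assume "a \<in> basis A" "b \<in> basis A"
  have r': "antisym r" "total_on (verts G) r"
    using r by (auto simp: linear_order_on_def partial_order_on_def)
  have alln: "takeWhile isl x = x" "filter isl x = x" if "filter (\<lambda>x. \<not> isl x) x = []"
    for x :: "('v + 'v set) list"
    using that by (auto simp: filter_empty_conv intro: filter_True)
  let ?c = "word_coeff r e T K"
  show "?c (u @ [a, b] @ v) = ksign (cdeg A a * cdeg A b) * ?c (u @ [b, a] @ v)"
  proof (cases a; cases b)
    fix i j assume ab: "a = Inl i" "b = Inl j"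
    hence "i \<in> verts G" "j \<in> verts G" using \<open>a \<in> basis A\<close> \<open>b \<in> basis A\<close> by (auto simp: basis_eq)
    from wedge_coeff_swap[OF r' this, of "map projl (filter isl u)" "map projl (filter isl v)"]
    show ?thesis
      by (simp add: word_coeff_def ab deg_simps ksign_def takeWhile_append)
  next
    fix i J assume ab: "a = Inl i" "b = Inr J"
    show ?thesis
    proof (cases "filter (\<lambda>x. \<not> isl x) u = [] \<and> filter (\<lambda>x. \<not> isl x) v = [] \<and> T = [J]")
      case True
      thus ?thesis using T
        by (auto simp: word_coeff_def ab deg_simps ksign_simps takeWhile_append filter_empty_conv
            alln distrib_left)
    next
      case False
      hence "map projr (filter (\<lambda>x. \<not> isl x) (u @ [a, b] @ v)) \<noteq> T"
        using T ab by (auto simp: append_eq_Cons_conv)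
      thus ?thesis by (simp add: word_coeff_def ab)
    qed
  next
    fix i J assume ab: "a = Inr J" "b = Inl i"
    show ?thesis
    proof (cases "filter (\<lambda>x. \<not> isl x) u = [] \<and> filter (\<lambda>x. \<not> isl x) v = [] \<and> T = [J]")
      case True
      thus ?thesis using T
        by (auto simp: word_coeff_def ab deg_simps ksign_simps takeWhile_append filter_empty_conv
            alln distrib_left)
    next
      case False
      hence "map projr (filter (\<lambda>x. \<not> isl x) (u @ [a, b] @ v)) \<noteq> T"
        using T ab by (auto simp: append_eq_Cons_conv)
      thus ?thesis by (simp add: word_coeff_def ab)
    qed
  next
    fix I J assume ab: "a = Inr I" "b = Inr J"
    have "length (map projr (filter (\<lambda>x. \<not> isl x) (u @ [a, b] @ v))) \<noteq> length T"
      "length (map projr (filter (\<lambda>x. \<not> isl x) (u @ [b, a] @ v))) \<noteq> length T"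
      using T ab by auto
    hence "map projr (filter (\<lambda>x. \<not> isl x) (u @ [a, b] @ v)) \<noteq> T"
      "map projr (filter (\<lambda>x. \<not> isl x) (u @ [b, a] @ v)) \<noteq> T" by blast+
    thus ?thesis unfolding word_coeff_def by simp
  qed
qed

lemma filter_map_Inl: "filter (\<lambda>x. \<not> isl x) (map Inl is) = []" "filter isl (map Inl is) = map Inl is"
    "map projl (map Inl is) = is"
  by (induction "is") auto

text \<open>Among all products \<open>x_b dx_a\<close>, only \<open>x_J dx_K\<close> contains the
  monomial \<open>x_J x_K\<close>. Every ordering of \<open>K\<close> contributes the same
  amount.\<close>

lemma edge_coeff:
  assumes "b \<in> basis A" "a \<in> basis A"
  shows "(\<Sum>w | dgen A a w \<noteq> 0. dgen A a w * word_coeff r e [J] K (b # w))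
    = (if (a, b) = (Inr K, Inr J) then 1 else 0)"
proof (cases a)
  case (Inr I)
  hence I: "I \<in> edges G" using assms by (auto simp: basis_eq)
  have fin: "finite I" using edge_props(2)[OF I] .
  \<comment> \<open>A leading edge letter has no vertex letters before it, so the sign in
    \<open>word_coeff\<close> is 1.\<close>
  have c: "word_coeff r e [J] K (b # map Inl is) = (if b = Inr J then wedge_coeff r is K else 0)" for "is"
    by (cases b) (simp_all add: word_coeff_def filter_map_Inl ksign_simps del: map_map)
  have "(\<Sum>is\<in>permutations_of_set I. wedge_coeff r is I / fact (card I) * word_coeff r e [J] K (b # map Inl is))
      = (\<Sum>is\<in>permutations_of_set I. if (a, b) = (Inr K, Inr J) then 1 / fact (card I) else 0)"
    by (rule sum.cong[OF refl])
       (auto simp: c Inr wedge_coeff_neg_count permutations_of_set_def simp flip: power_add)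
  thus ?thesis using fin by (simp add: Inr dgen_edge_sum[OF I])
qed (simp add: dgen_vertex)

text \<open>For \<open>T = []\<close> the functional sees monomials in vertices only:
  \<open>x_i dx_I\<close> is one, up to sign, unless it vanishes because \<open>i\<close> lies in
  \<open>I\<close>.\<close>

lemma vertex_coeff:
  assumes "b \<in> basis A" "a \<in> basis A"
  shows "(\<Sum>w | dgen A a w \<noteq> 0. dgen A a w * word_coeff r 0 [] K (b # w))
    = (case (b, a) of (Inl i, Inr I) \<Rightarrow>
         if i \<notin> I \<and> insert i I = K then (-1) ^ card {y \<in> I. (y, i) \<in> r} else 0
       | _ \<Rightarrow> 0)"
proof (cases a)
  case (Inr I)
  hence I: "I \<in> edges G" using assms by (auto simp: basis_eq)
  have fin: "finite I" using edge_props(2)[OF I] .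
  show ?thesis
  proof (cases b)
    case (Inl i)
    have c: "word_coeff r 0 [] K (b # map Inl is) = wedge_coeff r (i # is) K" for "is"
      by (simp add: Inl word_coeff_def filter_map_Inl ksign_simps del: map_map)
    have "(\<Sum>is\<in>permutations_of_set I. wedge_coeff r is I / fact (card I) * word_coeff r 0 [] K (b # map Inl is))
        = (\<Sum>is\<in>permutations_of_set I.
            (if i \<notin> I \<and> insert i I = K then (-1) ^ card {y \<in> I. (y, i) \<in> r} else 0) / fact (card I))"
    proof (rule sum.cong[OF refl])
      fix "is" assume "is \<in> permutations_of_set I"
      hence "distinct is" "set is = I" by (auto simp: permutations_of_set_def)
      from wedge_coeff_Cons[OF this, of r i K]
      show "wedge_coeff r is I / fact (card I) * word_coeff r 0 [] K (b # map Inl is)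
          = (if i \<notin> I \<and> insert i I = K then (-1) ^ card {y \<in> I. (y, i) \<in> r} else 0) / fact (card I)"
        by (simp add: c mult.commute)
    qed
    thus ?thesis using fin by (simp add: Inr Inl dgen_edge_sum[OF I])
  next
    case (Inr J)
    thus ?thesis by (simp add: word_coeff_def)
  qed
qed (simp add: dgen_vertex split: sum.split)

section \<open>Necessity: parity and Hall's condition\<close>

lemma symplectic_constraint:
  assumes "symplectic_form A \<omega>" "koszul_symmetric A c"
  shows "(\<Sum>(a, b)\<in>basis A \<times> basis A.
    \<omega> b a * (\<Sum>w | dgen A a w \<noteq> 0. dgen A a w * c (b # w))) = 0"
proof (rule closed_form_constraint[OF _ _ _ _ _ assms(2)])
  show "w \<in> lists (basis A) \<and> sum_list (map (cdeg A) w) = cdeg A a + 1" if "dgen A a w \<noteq> 0" for a w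
    by (rule dgen_support[OF that])
  show "\<omega> a b = - ksign (deg A a * deg A b) * \<omega> b a" if "a \<in> basis A" "b \<in> basis A" for a b
    using assms(1) that unfolding symplectic_form_def by blast
  show "MC_diff A (form_tensor A 2 (\<lambda>w. \<omega> (w ! 0) (w ! 1))) \<in> koszul_ideal A"
    using assms(1) unfolding symplectic_form_def by blast
qed (rule fin_basis fin_dgen)+

lemma symplectic_edge_edge:
  assumes \<omega>: "symplectic_form A \<omega>" and "J \<in> edges G" "K \<in> edges G"
  shows "\<omega> (Inr J) (Inr K) = 0"
proof -
  let ?c = "word_coeff r (cdeg A (Inr J)) [J] K"
  have "(\<Sum>(a, b)\<in>basis A \<times> basis A. \<omega> b a * (\<Sum>w | dgen A a w \<noteq> 0. dgen A a w * ?c (b # w)))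
      = (\<Sum>z\<in>basis A \<times> basis A. if z = (Inr K, Inr J) then \<omega> (Inr J) (Inr K) else 0)"
  proof (rule sum.cong[OF refl])
    fix z assume "z \<in> basis A \<times> basis A"
    then obtain a b where ab: "a \<in> basis A" "b \<in> basis A" and z: "z = (a, b)" by blast
    have "\<omega> b a * (\<Sum>w | dgen A a w \<noteq> 0. dgen A a w * ?c (b # w))
        = (if (a, b) = (Inr K, Inr J) then \<omega> (Inr J) (Inr K) else 0)"
      unfolding edge_coeff[OF ab(2,1)] by simp
    thus "(case z of (a, b) \<Rightarrow> \<omega> b a * (\<Sum>w | dgen A a w \<noteq> 0. dgen A a w * ?c (b # w)))
        = (if z = (Inr K, Inr J) then \<omega> (Inr J) (Inr K) else 0)" using z by simp
  qed
  also have "\<dots> = \<omega> (Inr J) (Inr K)"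
  proof -
    have "(Inr K, Inr J) \<in> basis A \<times> basis A" using assms(2,3) by (simp add: basis_eq)
    thus ?thesis using fin_basis by (simp add: sum.delta)
  qed
  finally show ?thesis
    using symplectic_constraint[OF \<omega> koszul_symmetric_word_coeff, of "[J]" "cdeg A (Inr J)" K] by simp
qed

text \<open>The graded sign can differ from the plain one only if both degrees are nonzero, hence
  only for two edges, where the form vanishes.\<close>

lemma symplectic_antisym:
  assumes \<omega>: "symplectic_form A \<omega>" and ab: "a \<in> basis A" "b \<in> basis A"
  shows "\<omega> a b = - \<omega> b a"
proof -
  have "\<omega> a b = - ksign (deg A a * deg A b) * \<omega> b a"
    using \<omega> ab unfolding symplectic_form_def by blast
  moreover have "\<omega> a b = 0 \<and> \<omega> b a = 0 \<or> deg A a * deg A b = 0"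
  proof (cases a; cases b)
    fix I J assume "a = Inr I" "b = Inr J"
    thus ?thesis using ab symplectic_edge_edge[OF \<omega>] by (auto simp: basis_eq)
  qed (simp_all add: deg_simps)
  ultimately show ?thesis by (auto simp: ksign_simps)
qed

lemma symplectic_nondegenerate:
  assumes \<omega>: "symplectic_form A \<omega>" and v: "\<And>b. b \<in> basis A \<Longrightarrow> (\<Sum>a\<in>basis A. v a * \<omega> a b) = 0"
    and a: "a \<in> basis A"
  shows "v a = 0"
proof -
  define v' where "v' a = (if a \<in> basis A then v a else 0)" for a
  have "nondegenerate_form A \<omega>" using \<omega> by (simp add: symplectic_form_def)
  moreover have sub: "{a. v' a \<noteq> 0} \<subseteq> basis A" by (auto simp: v'_def split: if_splits)
  moreover have fin: "finite {a. v' a \<noteq> 0}" by (rule finite_subset[OF sub fin_basis])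
  moreover have "(\<Sum>a | v' a \<noteq> 0. v' a * \<omega> a b) = 0" if "b \<in> basis A" for b
  proof -
    have "(\<Sum>a | v' a \<noteq> 0. v' a * \<omega> a b) = (\<Sum>a\<in>basis A. v' a * \<omega> a b)"
      using sub fin_basis by (intro sum.mono_neutral_left) auto
    also have "\<dots> = (\<Sum>a\<in>basis A. v a * \<omega> a b)" by (rule sum.cong) (auto simp: v'_def)
    finally show ?thesis using v[OF that] by simp
  qed
  ultimately have "v' a = 0" unfolding nondegenerate_form_def by blast
  thus ?thesis using a by (simp add: v'_def)
qed

lemma card_basis: "card (basis A) = card (edges G) + card (verts G)"
  using G fin_edges unfolding basis_eq finite_hypergraph_def
  by (subst card_Un_disjoint) (auto simp: card_image)

lemma symplectic_even:
  assumes "symplectic_form A \<omega>"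
  shows "even (card (edges G) + card (verts G))"
  unfolding card_basis[symmetric]
proof (rule nondegenerate_antisymmetric_imp_even_card)
  show "finite (basis A)" by (rule fin_basis)
  show "\<omega> a b = - \<omega> b a" if "a \<in> basis A" "b \<in> basis A" for a b
    by (rule symplectic_antisym[OF assms that])
  show "v a = 0" if "\<And>b. b \<in> basis A \<Longrightarrow> (\<Sum>a\<in>basis A. v a * \<omega> a b) = 0" "a \<in> basis A" for v a
    by (rule symplectic_nondegenerate[OF assms that])
qed

lemma symplectic_hall:
  assumes \<omega>: "symplectic_form A \<omega>" and P: "P \<subseteq> edges G"
  shows "card P \<le> card (\<Union>P)"
proof (rule ccontr)
  assume viol: "\<not> ?thesis"
  define \<V> where "\<V> = {S. S \<subseteq> edges G \<and> card (\<Union>S) < card S}"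
  have "finite \<V>" "P \<in> \<V>" using fin_edges P viol by (simp_all add: \<V>_def)
  from finite_has_maximal2[OF this]
  obtain S where "S \<in> \<V>" and max: "\<forall>S'\<in>\<V>. S \<subseteq> S' \<longrightarrow> S = S'" by (elim bexE conjE)
  hence S: "S \<subseteq> edges G" "card (\<Union>S) < card S" by (simp_all add: \<V>_def)
  have finS: "finite S" using fin_edges by (rule finite_subset[OF S(1)])
  have finU: "finite (\<Union>S)" using S finS edge_props(2) by auto
  text \<open>An edge \<open>J\<close> with \<open>insert j J = insert i I\<close> other than \<open>I\<close> contains \<open>i\<close>, and adding it
    to \<open>S\<close> would enlarge the union by \<open>i\<close> only.  So \<open>x\<^sub>i x\<^sub>I\<close> alone contributes to the coefficient
    of \<open>insert i I\<close> in the differential.\<close>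
  have outside: "\<omega> (Inl i) (Inr I) = 0" if i: "i \<in> verts G" "i \<notin> \<Union>S" and I: "I \<in> S" for i I
  proof -
    let ?K = "insert i I"
    have IE: "I \<in> edges G" using I S by auto
    have uniq: "j = i \<and> J = I" if J: "J \<in> edges G" "j \<notin> J" "insert j J = ?K" for j J
    proof (cases "j = i")
      case True
      thus ?thesis using J i I by auto
    next
      case False
      hence "i \<in> J" using J by auto
      hence "J \<notin> S" using i by auto
      have "\<Union>(insert J S) = insert i (\<Union>S)" using J I \<open>i \<in> J\<close> by auto
      \<comment> \<open>Both \<open>S\<close> and its union gain exactly one element, so the strict
        inequality persists.\<close>
      hence "insert J S \<in> \<V>" using S J \<open>J \<notin> S\<close> finS finU i by (auto simp: \<V>_def)
      with max have "S = insert J S" by (simp add: subset_insertI)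
      with \<open>J \<notin> S\<close> show ?thesis by auto
    qed
    have "0 = (\<Sum>(a, b)\<in>basis A \<times> basis A. \<omega> b a *
        (\<Sum>w | dgen A a w \<noteq> 0. dgen A a w * word_coeff r 0 [] ?K (b # w)))"
      using symplectic_constraint[OF \<omega> koszul_symmetric_word_coeff] by simp
    also have "\<dots> = (\<Sum>z\<in>basis A \<times> basis A. if z = (Inr I, Inl i)
        then \<omega> (Inl i) (Inr I) * (-1) ^ card {y \<in> I. (y, i) \<in> r} else 0)"
    proof (rule sum.cong[OF refl])
      fix z assume "z \<in> basis A \<times> basis A"
      then obtain a b where ab: "a \<in> basis A" "b \<in> basis A" and z: "z = (a, b)" by blast
      have "\<omega> b a * (\<Sum>w | dgen A a w \<noteq> 0. dgen A a w * word_coeff r 0 [] ?K (b # w))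
        = (if (a, b) = (Inr I, Inl i) then \<omega> (Inl i) (Inr I) * (-1) ^ card {y \<in> I. (y, i) \<in> r} else 0)"
        using ab uniq i I unfolding vertex_coeff[OF ab(2,1)]
        by (cases a; cases b) (auto simp: basis_eq)
      thus "(case z of (a, b) \<Rightarrow>
            \<omega> b a * (\<Sum>w | dgen A a w \<noteq> 0. dgen A a w * word_coeff r 0 [] ?K (b # w)))
        = (if z = (Inr I, Inl i) then \<omega> (Inl i) (Inr I) * (-1) ^ card {y \<in> I. (y, i) \<in> r} else 0)"
        using z by simp
    qed
    also have "\<dots> = \<omega> (Inl i) (Inr I) * (-1) ^ card {y \<in> I. (y, i) \<in> r}"
      using fin_basis i IE by (auto simp: basis_eq)
    finally show ?thesis by simp
  qed
  obtain v where v: "\<exists>I\<in>S. v I \<noteq> 0"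
    "\<And>i. i \<in> \<Union>S \<Longrightarrow> (\<Sum>I\<in>S. v I * \<omega> (Inr I) (Inl i)) = 0"
    using underdetermined_system[OF finU finS, of "\<lambda>i I. \<omega> (Inr I) (Inl i)"] S by auto
  \<comment> \<open>Extended by zero, the dependency lies in the kernel of \<omega>: edge columns
    vanish by \<open>symplectic_edge_edge\<close>, vertices outside the union by
    \<open>outside\<close>, and the others by the choice of \<open>v\<close>.\<close>
  define w where "w a = (case a of Inl i \<Rightarrow> 0 | Inr I \<Rightarrow> if I \<in> S then v I else 0)" for a :: "'v + 'v set"
  have sub: "Inr ` S \<subseteq> basis A" using S by (auto simp: basis_eq)
  have "(\<Sum>a\<in>basis A. w a * \<omega> a b) = 0" if b: "b \<in> basis A" for b
  proof -
    have "(\<Sum>a\<in>basis A. w a * \<omega> a b) = (\<Sum>a\<in>Inr ` S. w a * \<omega> a b)"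
      using sub fin_basis by (intro sum.mono_neutral_right) (auto simp: w_def split: sum.split)
    also have "\<dots> = (\<Sum>I\<in>S. v I * \<omega> (Inr I) b)"
      by (simp add: sum.reindex w_def)
    also have "\<dots> = 0"
    proof (cases b)
      case (Inr J)
      thus ?thesis using b S symplectic_edge_edge[OF \<omega>]
        by (intro sum.neutral) (auto simp: basis_eq)
    next
      case (Inl i)
      show ?thesis
      proof (cases "i \<in> \<Union>S")
        case False
        have "\<omega> (Inr I) (Inl i) = 0" if "I \<in> S" for I
          using outside[OF _ False that] symplectic_antisym[OF \<omega>, of "Inr I" "Inl i"] that b Inl sub
          by (auto simp: basis_eq)
        thus ?thesis using Inl by simp
      qed (use v Inl in simp)
    qed
    finally show ?thesis .
  qed
  from symplectic_nondegenerate[OF \<omega> this] v(1) sub show False by (fastforce simp: w_def)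
qed

lemma symplectic_imp_distinct_representatives:
  assumes \<omega>: "symplectic_form A \<omega>"
  shows "\<exists>f. distinct_representatives G f"
  unfolding distinct_representatives_def
  by (rule hall_marriage[of "edges G" "\<lambda>e. e"])
     (use fin_edges edge_props(2) symplectic_hall[OF \<omega>] in auto)

section \<open>Sufficiency: a form from distinct representatives\<close>

text \<open>Every word of \<open>dx_I\<close> contains the odd letter \<open>x_i\<close>, so
  multiplying by \<open>x_i\<close> repeats it. The other term of the derivation rule vanishes since
  \<open>dx_i = 0\<close>.\<close>

lemma incident_product_in_koszul_ideal:
  assumes I: "I \<in> edges G" and i: "i \<in> I"
  shows "dword A [Inr I, Inl i] \<in> koszul_ideal A" "dword A [Inl i, Inr I] \<in> koszul_ideal A"
proof -
  let ?D = "{w. dgen A (Inr I) w \<noteq> 0}"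
  have iB: "Inl i \<in> basis A" using edge_props(1)[OF I] i by (auto simp: basis_eq)
  have odd: "odd (cdeg A (Inl i))" by (simp add: deg_simps)
  have split: "\<exists>u v. w = u @ Inl i # v \<and> u \<in> lists (basis A) \<and> v \<in> lists (basis A)" if "w \<in> ?D" for w
  proof -
    have "Inl i \<in> set w" using that i by (auto elim!: dgen_nonzero[OF G r A_eq])
    then obtain u v where "w = u @ Inl i # v" by (auto simp: in_set_conv_decomp)
    moreover have "w \<in> lists (basis A)" using that dgen_support by auto
    ultimately show ?thesis by auto
  qed
  have 1: "word (w @ [Inl i]) \<in> koszul_ideal A" if w: "w \<in> ?D" for w
  proof -
    obtain u v where uv: "w = u @ Inl i # v" "u \<in> lists (basis A)" "v \<in> lists (basis A)"
      using split[OF w] by blast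
    show ?thesis using word_repeated_in_koszul_ideal[OF iB odd uv(2,3), of "[]"] uv(1) by simp
  qed
  have 2: "word (Inl i # w) \<in> koszul_ideal A" if w: "w \<in> ?D" for w
  proof -
    obtain u v where uv: "w = u @ Inl i # v" "u \<in> lists (basis A)" "v \<in> lists (basis A)"
      using split[OF w] by blast
    show ?thesis using word_repeated_in_koszul_ideal[OF iB odd _ uv(2,3), of "[]"] uv(1) by simp
  qed
  note e = expand_words[OF fin_dgen subset_refl]
  have "tmul (dgen A (Inr I)) (word [Inl i]) \<in> koszul_ideal A"
    by (subst e) (auto simp: tmul_sum_left tmul_scale_left tmul_word
        intro!: koszul_ideal_sum koszul_ideal.scale 1)
  thus "dword A [Inr I, Inl i] \<in> koszul_ideal A" by (simp add: dgen_vertex)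
  have "tmul (word [Inl i]) (dgen A (Inr I)) \<in> koszul_ideal A"
    by (subst e) (auto simp: tmul_sum_right tmul_scale_right tmul_word
        intro!: koszul_ideal_sum koszul_ideal.scale 2)
  thus "dword A [Inl i, Inr I] \<in> koszul_ideal A" by (simp add: dgen_vertex koszul_ideal.scale)
qed

lemma distinct_representatives_imp_symplectic:
  assumes even: "even (card (edges G) + card (verts G))" and f: "distinct_representatives G f"
  shows "\<exists>\<omega>. symplectic_form A \<omega>"
proof -
  let ?E = "edges G" and ?V = "verts G"
  have f: "inj_on f ?E" "\<And>I. I \<in> ?E \<Longrightarrow> f I \<in> I"
    using f by (auto simp: distinct_representatives_def)
  have sub: "f ` ?E \<subseteq> ?V" using f(2) edge_props(1) by blast
  have finV: "finite ?V" using G by (simp add: finite_hypergraph_def)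
  let ?R = "?V - f ` ?E"
  \<comment> \<open>The vertices representing no edge number \<open>card ?V - card ?E\<close>, which
    has the parity of the sum.\<close>
  have "card ?R = card ?V - card ?E" "card ?E \<le> card ?V"
    using sub finV fin_edges card_image[OF f(1)] card_mono[OF finV sub]
    by (simp_all add: card_Diff_subset)
  hence "even (card ?R)" using even by auto
  then obtain X g where X: "X \<subseteq> ?R" "inj_on g X" "g ` X = ?R - X"
    using even_card_pairing[of ?R] finV by auto
  \<comment> \<open>\<open>P\<close> takes one member of each pair: every edge, and half of the
    vertices that represent none.\<close>
  define P :: "('v + 'v set) set" where "P = Inr ` ?E \<union> Inl ` X"
  define h :: "'v + 'v set \<Rightarrow> 'v + 'v set" where
    "h b = (case b of Inr I \<Rightarrow> Inl (f I) | Inl x \<Rightarrow> Inl (g x))" for b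
  have h1: "h ` Inr ` ?E = Inl ` f ` ?E" and h2: "h ` Inl ` X = Inl ` (?R - X)"
    by (simp_all add: image_image h_def flip: X(3))
  have "inj_on h (Inr ` ?E)" "inj_on h (Inl ` X)"
    using f(1) X(2) by (auto simp: inj_on_def h_def)
  moreover have "h ` Inr ` ?E \<inter> h ` Inl ` X = {}" unfolding h1 h2 by auto
  moreover have "Inr ` ?E - Inl ` X = Inr ` ?E" "Inl ` X - Inr ` ?E = Inl ` X" by auto
  ultimately have h: "inj_on h P" unfolding P_def inj_on_Un by simp
  have hP: "h ` P = Inl ` f ` ?E \<union> Inl ` (?R - X)" unfolding P_def image_Un h1 h2 ..
  have disj: "P \<inter> h ` P = {}" unfolding hP using X(1) by (auto simp: P_def)
  have B: "basis A = P \<union> h ` P" unfolding hP using X(1) sub by (auto simp: basis_eq P_def)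
  let ?\<omega> = "pairing_form P h"
  have "symplectic_form A ?\<omega>"
    unfolding symplectic_form_def
  proof (intro conjI ballI)
    show "finite {(a, b) \<in> basis A \<times> basis A. ?\<omega> a b \<noteq> 0}"
      by (rule finite_subset[of _ "basis A \<times> basis A"]) (auto simp: fin_basis)
    show "nondegenerate_form A ?\<omega>" by (rule nondegenerate_pairing_form[OF h disj B])
    \<comment> \<open>Every partner is a vertex of degree 0, so graded antisymmetry reduces to plain
      antisymmetry on matched pairs.\<close>
    have "deg A (h a) = 0" for a by (auto simp: h_def deg_simps split: sum.split)
    thus "?\<omega> a b = - ksign (deg A a * deg A b) * ?\<omega> b a" for a b
      using disj by (auto simp: pairing_form_def ksign_simps)
    \<comment> \<open>A nonzero value pairs either two vertices, whose product has zero
      differential, or an edge with its representative.\<close>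
    have "(\<lambda>u. ksign (deg A a) * ?\<omega> a b / 2 * dword A [a, b] u) \<in> koszul_ideal A" for a b
    proof (cases "?\<omega> a b = 0")
      case True
      thus ?thesis by (simp add: koszul_ideal.zero)
    next
      case False
      then obtain c where c: "c \<in> P" "a = c \<and> b = h c \<or> b = c \<and> a = h c"
        by (auto simp: pairing_form_def split: if_splits)
      have "dword A [a, b] \<in> koszul_ideal A"
      proof (cases c)
        case (Inl x)
        have "dword A [a, b] = (\<lambda>_. 0)"
          using c(2) dword_Inl[OF G r A_eq, of "[x, g x]"] dword_Inl[OF G r A_eq, of "[g x, x]"]
          by (auto simp del: dword.simps simp: Inl h_def)
        thus ?thesis by (simp only: koszul_ideal.zero)
      next
        case (Inr I)
        hence "I \<in> ?E" using c(1) by (auto simp: P_def)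
        thus ?thesis using c(2) incident_product_in_koszul_ideal[of I "f I"] f(2)
          by (auto simp del: dword.simps simp: Inr h_def)
      qed
      thus ?thesis by (rule koszul_ideal.scale)
    qed
    thus "MC_diff A (form_tensor A 2 (\<lambda>w. ?\<omega> (w ! 0) (w ! 1))) \<in> koszul_ideal A"
      unfolding MC_diff_form2[OF fin_basis] case_prod_unfold by (rule koszul_ideal_sum)
  qed
  thus ?thesis by blast
qed

end

theorem theorem13:
  fixes G :: "'v hypergraph" and r :: "'v rel"
  assumes "hypergraph G" and "finite_hypergraph G" and "simple_hypergraph G"
    and "linear_order_on (verts G) r"
  shows "(\<exists>\<omega>. symplectic_form (hypergraph_algebra r G) \<omega>) \<longleftrightarrow>
    even (card (edges G) + card (verts G)) \<and> (\<exists>f. distinct_representatives G f)"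
  using symplectic_even[OF assms(1,2,4) refl]
    symplectic_imp_distinct_representatives[OF assms(1,2,4) refl]
    distinct_representatives_imp_symplectic[OF assms(1,2,4) refl] by blast

end
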